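(* Let $\Omega\subset\mathbb R^3$ be a region subdivided by a tetrahedral grid with barycentric dual grid, let $n$ be a node of the grid, and let $\tilde c=\tilde c_n$ be its dual cell. The following two assertions hold. (1) If $\tilde c$ does not intersect $\partial\Omega$, then $$\sum_{e \in E(n)} \boldsymbol e_{|\tilde c} \otimes \tilde{\boldsymbol f}_e = |\tilde c|\, \mathbb I_3, \qquad \sum_{f \in F(n)} \boldsymbol f_{|\tilde c} \otimes \tilde{\boldsymbol e}_f = |\tilde c|\, \mathbb I_3 .$$ (2) If $\tilde c$ does intersect $\partial\Omega$, then $$\sum_{e \in E(n)} \boldsymbol e_{|\tilde c} \otimes (\tilde{\boldsymbol f}_e + \boldsymbol s_{n,e}) = |\tilde c|\, \mathbb I_3, \qquad \sum_{f \in F(n)} \boldsymbol f_{|\tilde c} \otimes (\tilde{\boldsymbol e}_f + \boldsymbol l_{n,f}) = |\tilde c|\, \mathbb I_3 .$$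
   Context: All vectors are column vectors in $\mathbb R^3$; $\boldsymbol a\otimes\boldsymbol b=\boldsymbol a\boldsymbol b^T$; $\mathbb I_3$ is the $3\times3$ identity. The grid is a (conforming) tetrahedral grid of $\Omega$ with nodes, edges, faces and cells (nondegenerate tetrahedra); each edge and face carries a fixed, arbitrarily chosen orientation. $E(n),F(n),C(n)$ are the sets of edges, faces, cells containing the node $n$; $C(e)$, $C(f)$ are the sets of cells containing the edge $e$, the face $f$. $\boldsymbol b_e,\boldsymbol b_f,\boldsymbol b_c$ are the barycenters of $e$, $f$, $c$; $\tilde{\boldsymbol n}_c=\boldsymbol b_c$. Nodes are identified with their coordinate vectors. - $\boldsymbol e$: difference of the endpoints of $e$, oriented as $e$. $\boldsymbol f=|f|\boldsymbol n_f$: area times the unit normal given by the orientation of $f$. - Dual cell: $\tilde c_n=\bigcup_{c\in C(n)}\tilde c_{n|c}$, where $\tilde c_{n|c}$ is the union of the six tetrahedra with vertices $n,\boldsymbol b_e,\boldsymbol b_f,\boldsymbol b_c$ with $n\in e\subset f\subset c$; $|\tilde c|$ is the volume of $\tilde c_n$. - $\boldsymbol e_{|\tilde c}$ and $\boldsymbol f_{|\tilde c}$ are the edge vector of $e\cap\tilde c$ and the face vector of $f\cap\tilde c$, oriented as $e$ and $f$. By the barycentric subdivision, $\boldsymbol e_{|\tilde c}=\tfrac12\boldsymbol e$ and $\boldsymbol f_{|\tilde c}=\tfrac13\boldsymbol f$. - Dual edge vector: $\tilde{\boldsymbol e}_f=\sum_{c\in C(f)}\tilde{\boldsymbol e}_{f|c}$,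 where $\tilde{\boldsymbol e}_{f|c}=\pm(\boldsymbol b_f-\tilde{\boldsymbol n}_c)$ with the sign chosen so that $\tilde{\boldsymbol e}_{f|c}\cdot\boldsymbol f>0$ ($\tilde e_{f|c}$ is the corresponding oriented segment). - Dual face vector: $\tilde{\boldsymbol f}_e=\sum_{c\in C(e)}\tilde{\boldsymbol f}_{e|c}$. Here $\tilde f_{e|c}$ is the plane quadrilateral with vertices $\tilde{\boldsymbol n}_c,\boldsymbol b_{f_1},\boldsymbol b_e,\boldsymbol b_{f_2}$, where $f_1,f_2$ are the two faces of $c$ containing $e$, and its face vector is $\tilde{\boldsymbol f}_{e|c}=\tfrac12(\boldsymbol b_{f_1}-\boldsymbol b_{f_2})\times(\boldsymbol b_e-\tilde{\boldsymbol n}_c)$, with $f_1,f_2$ ordered so that $\tilde{\boldsymbol f}_{e|c}\cdot\boldsymbol e>0$. - Boundary term $\boldsymbol s_{n,e}=\sum_{c\in C(e)}\boldsymbol s_{n,e|c}$. For $e\in E(n)$ with other endpoint $n_1$, let $\boldsymbol p_{n,e}=\tfrac34\boldsymbol n+\tfrac14\boldsymbol n_1$. For $c\in C(e)$, $s_{n,e|c}$ is the union of the triangles with vertices $\{\boldsymbol b_e,\boldsymbol b_{f_1},\boldsymbol p_{n,e}\}$ and $\{\boldsymbol b_e,\boldsymbol b_{f_2},\boldsymbol p_{n,e}\}$ ($f_1,f_2$ the faces of $c$ containing $e$), each oriented so that it and $\tilde f_{e|c}$ induce opposite orientations on their common edge; $\boldsymbol s_{n,e|c}$ is the sum of the two face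 vectors. Explicitly, with the two faces $f_1,f_2$ of $c$ containing $e$ ordered so that $\tfrac12\big((\boldsymbol b_{f_1}-\boldsymbol b_{f_2})\times(\boldsymbol b_e-\tilde{\boldsymbol n}_c)\big)\cdot\boldsymbol e>0$, $\boldsymbol s_{n,e|c}=\tfrac12(\boldsymbol b_{f_1}-\boldsymbol b_e)\times(\boldsymbol p_{n,e}-\boldsymbol b_e)+\tfrac12(\boldsymbol p_{n,e}-\boldsymbol b_e)\times(\boldsymbol b_{f_2}-\boldsymbol b_e)$. - Boundary term $\boldsymbol l_{n,f}=\sum_{c\in C(f)}\boldsymbol l_{n,f|c}$. For $f\in F(n)$ with other nodes $n_1,n_2$, let $\boldsymbol p_{n,f}=\tfrac12\boldsymbol n+\tfrac14\boldsymbol n_1+\tfrac14\boldsymbol n_2$. $l_{n,f|c}$ is the segment joining $\boldsymbol b_f$ and $\boldsymbol p_{n,f}$, oriented so that it and $\tilde e_{f|c}$ induce opposite orientations on their common node. That is, $\boldsymbol l_{n,f|c}=\boldsymbol p_{n,f}-\boldsymbol b_f$ if $\tilde{\boldsymbol e}_{f|c}=\boldsymbol b_f-\tilde{\boldsymbol n}_c$, and $\boldsymbol l_{n,f|c}=\boldsymbol b_f-\boldsymbol p_{n,f}$ if $\tilde{\boldsymbol e}_{f|c}=\tilde{\boldsymbol n}_c-\boldsymbol b_f$. *)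

theory Defs
  imports "HOL-Analysis.Analysis"
begin

type_synonym point = "real^3"

definition outer :: "point \<Rightarrow> point \<Rightarrow> real^3^3" where
  "outer a b = (\<chi> i j. a $ i * b $ j)"


subsection \<open>Tetrahedral grids\<close>

text \<open>
  Cells, faces and edges are closed point sets, so incidence is plain set inclusion. Only the
  closure of \<Omega> is determined by the grid; this covers both an open domain and the closed
  polyhedron it bounds. Conformity is part of \<^const>\<open>triangulation\<close>: two cells meet in
  a common (possibly empty) face.
\<close>

definition tetrahedral_grid :: "point set \<Rightarrow> point set set \<Rightarrow> bool" where
  "tetrahedral_grid \<Omega> \<T> \<longleftrightarrow>
     triangulation \<T> \<and> (\<forall>c\<in>\<T>. 3 simplex c) \<and> \<Union>\<T> = closure \<Omega>"

definition vertices :: "point set \<Rightarrow> point set" where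
  "vertices S = {v. v extreme_point_of S}"

definition grid_nodes :: "point set set \<Rightarrow> point set" where
  "grid_nodes \<T> = (\<Union>c\<in>\<T>. vertices c)"

definition grid_edges :: "point set set \<Rightarrow> point set set" where
  "grid_edges \<T> = {e. \<exists>c\<in>\<T>. e edge_of c}"

definition grid_faces :: "point set set \<Rightarrow> point set set" where
  "grid_faces \<T> = {f. \<exists>c\<in>\<T>. f facet_of c}"

definition edges_at :: "point set set \<Rightarrow> point \<Rightarrow> point set set" where
  "edges_at \<T> n = {e \<in> grid_edges \<T>. n \<in> e}"

definition faces_at :: "point set set \<Rightarrow> point \<Rightarrow> point set set" where
  "faces_at \<T> n = {f \<in> grid_faces \<T>. n \<in> f}"

definition cells_at :: "point set set \<Rightarrow> point \<Rightarrow> point set set" where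
  "cells_at \<T> n = {c \<in> \<T>. n \<in> c}"

text \<open>The cells containing a given edge or face.\<close>

definition cells_containing :: "point set set \<Rightarrow> point set \<Rightarrow> point set set" where
  "cells_containing \<T> s = {c \<in> \<T>. s \<subseteq> c}"

definition barycenter :: "point set \<Rightarrow> point" where
  "barycenter S = (\<Sum>v\<in>vertices S. v) /\<^sub>R real (card (vertices S))"


subsection \<open>Orientations, edge vectors and face vectors\<close>

text \<open>An edge is oriented by a pair (tail, head), a face by a unit normal.\<close>

definition edge_orientation :: "point set set \<Rightarrow> (point set \<Rightarrow> point \<times> point) \<Rightarrow> bool" where
  "edge_orientation \<T> oe \<longleftrightarrow> (\<forall>e\<in>grid_edges \<T>. vertices e = {fst (oe e), snd (oe e)})"

definition face_orientation :: "point set set \<Rightarrow> (point set \<Rightarrow> point) \<Rightarrow> bool" where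
  "face_orientation \<T> \<nu> \<longleftrightarrow>
     (\<forall>f\<in>grid_faces \<T>. norm (\<nu> f) = 1 \<and> (\<forall>x\<in>f. \<forall>y\<in>f. \<nu> f \<bullet> (x - y) = 0))"

definition edge_vec :: "(point set \<Rightarrow> point \<times> point) \<Rightarrow> point set \<Rightarrow> point" where
  "edge_vec oe e = snd (oe e) - fst (oe e)"

text \<open>
  The area of a set \<open>S\<close> lying in a plane with unit normal \<open>u\<close>, expressed through
  three-dimensional Lebesgue measure as the volume of the right prism of height 1 over \<open>S\<close>.
\<close>

definition planar_area :: "point \<Rightarrow> point set \<Rightarrow> real" where
  "planar_area u S = measure lebesgue {x + t *\<^sub>R u | x t. x \<in> S \<and> 0 \<le> t \<and> t \<le> 1}"

definition face_vec :: "(point set \<Rightarrow> point) \<Rightarrow> point set \<Rightarrow> point" where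
  "face_vec \<nu> f = planar_area (\<nu> f) f *\<^sub>R \<nu> f"


subsection \<open>Dual cells\<close>

definition dual_cell_part :: "point \<Rightarrow> point set \<Rightarrow> point set" where
  "dual_cell_part n c =
     \<Union>{convex hull {n, barycenter e, barycenter f, barycenter c} | e f.
          e edge_of c \<and> f facet_of c \<and> n \<in> e \<and> e \<subseteq> f}"

definition dual_cell :: "point set set \<Rightarrow> point \<Rightarrow> point set" where
  "dual_cell \<T> n = (\<Union>c\<in>cells_at \<T> n. dual_cell_part n c)"

text \<open>
  The vectors of the segment \<open>e \<inter> dual_cell \<T> n\<close> and of the plane polygon
  \<open>f \<inter> dual_cell \<T> n\<close>, oriented as \<open>e\<close> and \<open>f\<close>.
\<close>

definition edge_vec_in_dual ::
    "point set set \<Rightarrow> (point set \<Rightarrow> point \<times> point) \<Rightarrow> point \<Rightarrow> point set \<Rightarrow> point" where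
  "edge_vec_in_dual \<T> oe n e =
     (THE v. \<exists>x y. e \<inter> dual_cell \<T> n = closed_segment x y \<and> v = y - x \<and> v \<bullet> edge_vec oe e > 0)"

definition face_vec_in_dual ::
    "point set set \<Rightarrow> (point set \<Rightarrow> point) \<Rightarrow> point \<Rightarrow> point set \<Rightarrow> point" where
  "face_vec_in_dual \<T> \<nu> n f = planar_area (\<nu> f) (f \<inter> dual_cell \<T> n) *\<^sub>R \<nu> f"


subsection \<open>Dual edge vectors and dual face vectors\<close>

definition dual_edge_vec_part :: "(point set \<Rightarrow> point) \<Rightarrow> point set \<Rightarrow> point set \<Rightarrow> point" where
  "dual_edge_vec_part \<nu> f c =
     (THE v. v \<in> {barycenter f - barycenter c, - (barycenter f - barycenter c)} \<and>
             v \<bullet> face_vec \<nu> f > 0)"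

definition dual_edge_vec :: "point set set \<Rightarrow> (point set \<Rightarrow> point) \<Rightarrow> point set \<Rightarrow> point" where
  "dual_edge_vec \<T> \<nu> f = (\<Sum>c\<in>cells_containing \<T> f. dual_edge_vec_part \<nu> f c)"

definition dual_quad_vec :: "point set \<Rightarrow> point set \<Rightarrow> point set \<Rightarrow> point set \<Rightarrow> point" where
  "dual_quad_vec f1 f2 e c =
     (1/2) *\<^sub>R cross3 (barycenter f1 - barycenter f2) (barycenter e - barycenter c)"

text \<open>
  The two faces of \<open>c\<close> containing \<open>e\<close>, in the order that makes the dual face vector point
  in the direction of \<open>e\<close>. Exchanging the faces negates \<^const>\<open>dual_quad_vec\<close>, so the
  order is unique.
\<close>

definition ordered_faces ::
    "(point set \<Rightarrow> point \<times> point) \<Rightarrow> point set \<Rightarrow> point set \<Rightarrow> point set \<times> point set" where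
  "ordered_faces oe e c =
     (THE (f1, f2). {f. f facet_of c \<and> e \<subseteq> f} = {f1, f2} \<and>
                    dual_quad_vec f1 f2 e c \<bullet> edge_vec oe e > 0)"

definition dual_face_vec_part ::
    "(point set \<Rightarrow> point \<times> point) \<Rightarrow> point set \<Rightarrow> point set \<Rightarrow> point" where
  "dual_face_vec_part oe e c = (case ordered_faces oe e c of (f1, f2) \<Rightarrow> dual_quad_vec f1 f2 e c)"

definition dual_face_vec ::
    "point set set \<Rightarrow> (point set \<Rightarrow> point \<times> point) \<Rightarrow> point set \<Rightarrow> point" where
  "dual_face_vec \<T> oe e = (\<Sum>c\<in>cells_containing \<T> e. dual_face_vec_part oe e c)"


subsection \<open>Boundary terms\<close>

text \<open>The sums below range over the one other endpoint of \<open>e\<close>, the two other nodes of \<open>f\<close>.\<close>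

definition edge_point :: "point \<Rightarrow> point set \<Rightarrow> point" where
  "edge_point n e = (3/4) *\<^sub>R n + (\<Sum>m\<in>vertices e - {n}. (1/4) *\<^sub>R m)"

definition face_point :: "point \<Rightarrow> point set \<Rightarrow> point" where
  "face_point n f = (1/2) *\<^sub>R n + (\<Sum>m\<in>vertices f - {n}. (1/4) *\<^sub>R m)"

definition bdry_face_vec_part ::
    "(point set \<Rightarrow> point \<times> point) \<Rightarrow> point \<Rightarrow> point set \<Rightarrow> point set \<Rightarrow> point" where
  "bdry_face_vec_part oe n e c =
     (case ordered_faces oe e c of (f1, f2) \<Rightarrow>
        (1/2) *\<^sub>R cross3 (barycenter f1 - barycenter e) (edge_point n e - barycenter e) +
        (1/2) *\<^sub>R cross3 (edge_point n e - barycenter e) (barycenter f2 - barycenter e))"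

definition bdry_face_vec ::
    "point set set \<Rightarrow> (point set \<Rightarrow> point \<times> point) \<Rightarrow> point \<Rightarrow> point set \<Rightarrow> point" where
  "bdry_face_vec \<T> oe n e = (\<Sum>c\<in>cells_containing \<T> e. bdry_face_vec_part oe n e c)"

definition bdry_edge_vec_part ::
    "(point set \<Rightarrow> point) \<Rightarrow> point \<Rightarrow> point set \<Rightarrow> point set \<Rightarrow> point" where
  "bdry_edge_vec_part \<nu> n f c =
     (if dual_edge_vec_part \<nu> f c = barycenter f - barycenter c
      then face_point n f - barycenter f
      else barycenter f - face_point n f)"

definition bdry_edge_vec ::
    "point set set \<Rightarrow> (point set \<Rightarrow> point) \<Rightarrow> point \<Rightarrow> point set \<Rightarrow> point" where
  "bdry_edge_vec \<T> \<nu> n f = (\<Sum>c\<in>cells_containing \<T> f. bdry_edge_vec_part \<nu> n f c)"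

end

theory Submission
  imports Defs
begin

text \<open>
  Inside a cell, the dual cell of \<open>n\<close> is the region where the barycentric coordinate of \<open>n\<close> is the
  largest one, so by symmetry it has a quarter of the volume of the cell, and it cuts off a third of each
  face and half of each edge at \<open>n\<close>. Put \<open>n = 0\<close> and let \<open>a\<close>, \<open>b\<close>, \<open>d\<close> be the other vertices of the
  cell. Together with the boundary terms, the contribution of the cell to the dual face vector of the
  edge \<open>a\<close> is \<open>\<plusminus>(b \<times> d) / 12\<close>, and its contribution to the dual edge vector of the face spanned by \<open>a\<close>
  and \<open>b\<close> is \<open>\<plusminus>d / 4\<close>; the identity \<open>a (b \<times> d)\<^sup>T + b (d \<times> a)\<^sup>T + d (a \<times> b)\<^sup>T = det (a, b, d) I\<close> then
  gives the second assertion cell by cell. If the dual cell avoids the boundary, every face at \<open>n\<close> has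
  exactly two cells, one on each side, and their boundary terms cancel.
\<close>

subsection \<open>Measures of symmetric regions\<close>

text \<open>The points \<open>edge_point\<close> and \<open>face_point\<close>, here p_e and p_f,
  make each cell close up on its own. Put \<open>n = 0\<close> and let b_f, b_c be barycenters. A
  face term is a sign times p_f - b_c, and p_f = (a + b)/4 removes from b_c all but the part along
  the opposite vertex. An edge term is a sign times (b_f1 - b_f2) x (p_e - b_c) / 2, and p_e = a/4
  leaves -(b + d)/4 in the second factor. The vectors inside the dual cell contribute 1/2 and 1/6,
  so both kinds of term carry 1/2 * 1/12 = 1/6 * 1/4 = 1/24, a quarter of the 1/6 in the volume of a
  cell. Two obstacles shape the rest. Traces on edges and faces are point sets cut out by a dual
  cell that is assembled from all cells at \<open>n\<close>; conformity reduces them to a single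
  cell. And that an interior face has one cell on each side has to be derived, from the topology
  near its barycenter. It enters only as a vanishing sum of signs; for an edge, the two boundary
  triangles in a cell must first be attributed to the two faces through the edge.\<close>

text \<open>The map \<open>x \<mapsto> x + (l 0 x - l k x) e k\<close> is a volume-preserving involution that exchanges \<open>l 0\<close> and
  \<open>l k\<close>, so all the parts \<open>D k\<close> have the same measure.\<close>

lemma measure_dominant_part:
  fixes m :: nat and a e :: "nat \<Rightarrow> real^3" and b :: "nat \<Rightarrow> real" and K :: "(real^3) set"
  defines "l \<equiv> \<lambda>k x. a k \<bullet> x + b k"
  defines "D \<equiv> \<lambda>k. {x\<in>K. \<forall>j<m. 0 \<le> l j x \<and> l j x \<le> l k x}"
  assumes "0 < m"
    and e: "\<And>k. 0 < k \<Longrightarrow> k < m \<Longrightarrow> a k \<bullet> e k = 1" "\<And>k. 0 < k \<Longrightarrow> k < m \<Longrightarrow> a 0 \<bullet> e k = -1"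
      "\<And>j k. 0 < k \<Longrightarrow> k < m \<Longrightarrow> 0 < j \<Longrightarrow> j < m \<Longrightarrow> j \<noteq> k \<Longrightarrow> a j \<bullet> e k = 0"
    and K: "\<And>k x. 0 < k \<Longrightarrow> k < m \<Longrightarrow> x \<in> K \<Longrightarrow> x + (l 0 x - l k x) *\<^sub>R e k \<in> K"
    and "closed K" and "bounded {x\<in>K. \<forall>j<m. 0 \<le> l j x}"
  shows "measure lebesgue {x\<in>K. \<forall>j<m. 0 \<le> l j x} = real m * measure lebesgue (D 0)"
proof -
  let ?B = "{x\<in>K. \<forall>j<m. 0 \<le> l j x}"
  have Dm: "D k \<in> lmeasurable" for k
  proof -
    have "D k = K \<inter> (\<Inter>j\<in>{..<m}. {x. 0 \<le> l j x} \<inter> {x. l j x \<le> l k x})" by (auto simp: D_def)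
    moreover have "closed \<dots>" unfolding l_def
      by (intro closed_Int closed_INT ballI \<open>closed K\<close> closed_Collect_le continuous_intros)
    moreover have "bounded (D k)" by (rule bounded_subset[OF assms(9)]) (auto simp: D_def)
    ultimately show ?thesis by (auto intro!: lmeasurable_compact simp: compact_eq_bounded_closed)
  qed
  \<comment> \<open>Distinct gradients make \<open>l j x = l k x\<close> a genuine hyperplane, so
    two parts overlap in a null set.\<close>
  have anz: "a j \<noteq> a k" if "j < m" "k < m" "j \<noteq> k" for j k
  proof (cases "k = 0")
    case True
    then show ?thesis using e(1,2)[of j] that by auto
  next
    case False
    then show ?thesis using e(1,2)[of k] e(3)[of k j] that by (cases "j = 0") auto
  qed
  have neg: "pairwise (\<lambda>j k. negligible (D j \<inter> D k)) {..<m}"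
    unfolding pairwise_def
  proof (intro ballI impI)
    fix j k assume "j \<in> {..<m}" "k \<in> {..<m}" "j \<noteq> k"
    then have "D j \<inter> D k \<subseteq> {x. (a j - a k) \<bullet> x = b k - b j}"
      by (force simp: D_def l_def inner_diff_left)
    moreover have "negligible {x. (a j - a k) \<bullet> x = b k - b j}"
      using anz[of j k] \<open>j \<in> _\<close> \<open>k \<in> _\<close> \<open>j \<noteq> k\<close> by (intro negligible_hyperplane) auto
    ultimately show "negligible (D j \<inter> D k)" by (rule negligible_subset[rotated])
  qed
  have eq: "measure lebesgue (D k) = measure lebesgue (D 0)" if "k < m" for k
  proof (cases "k = 0")
    case False
    define r where "r x = x + (l 0 x - l k x) *\<^sub>R e k" for x
    define f where "f x = x + ((a 0 - a k) \<bullet> x) *\<^sub>R e k" for x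
    have ek: "a k \<bullet> e k = 1" "a 0 \<bullet> e k = -1" and ej: "\<And>j. 0 < j \<Longrightarrow> j < m \<Longrightarrow> j \<noteq> k \<Longrightarrow> a j \<bullet> e k = 0"
      using e that False by auto
    have rl: "l k (r x) = l 0 x" "l 0 (r x) = l k x" for x
      using ek by (auto simp: r_def l_def inner_add_right algebra_simps)
    have rj: "l j (r x) = l j x" if "0 < j" "j < m" "j \<noteq> k" for x j
      using ej[OF that] by (auto simp: r_def l_def inner_add_right algebra_simps)
    have rr: "r (r x) = x" for x
      using rl[of x] unfolding r_def[of "r x"] by (simp add: r_def algebra_simps)
    have rK: "r x \<in> K" if "x \<in> K" for x
      using K[OF _ \<open>k < m\<close> that] False by (auto simp: r_def)
    \<comment> \<open>Asking only for \<open>{k', k''} = {0, k}\<close> covers both directions of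
      the exchange at once.\<close>
    have sw: "r x \<in> D k'" if "x \<in> D k''" "{k', k''} = {0, k}" for x k' k''
    proof -
      have "0 \<le> l j (r x) \<and> l j (r x) \<le> l k' (r x)" if "j < m" for j
      proof -
        consider "j = 0" | "j = k" | "0 < j" "j \<noteq> k" by auto
        then show ?thesis
          using \<open>x \<in> D k''\<close> \<open>{k', k''} = {0, k}\<close> rl[of x] rj[of j x] that \<open>0 < m\<close> \<open>k < m\<close>
          by cases (auto simp: D_def doubleton_eq_iff)
      qed
      then show ?thesis using rK[of x] that by (auto simp: D_def)
    qed
    have im: "D 0 = r ` D k"
    proof safe
      fix x assume "x \<in> D 0"
      then show "x \<in> r ` D k" using sw[of x 0 k] rr[of x] by (metis image_eqI insert_commute)
    qed (use sw[of _ k 0] in auto)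
    have lf: "linear f"
      by (intro linearI) (auto simp: f_def algebra_simps inner_add_right)
    \<comment> \<open>The linear part is an involution as well, because
      \<open>(a 0 - a k) \<bullet> e k = -2\<close>; hence its determinant has square 1.\<close>
    have "f \<circ> f = id"
      using ek by (auto simp: f_def fun_eq_iff algebra_simps inner_add_right inner_diff_left simp flip: scaleR_add_left)
    then have "det (matrix f) * det (matrix f) = 1"
      by (metis det_I det_mul lf matrix_compose matrix_id_mat_1)
    then have det: "\<bar>det (matrix f)\<bar> = 1" by (metis abs_mult_self_eq abs_of_nonneg zero_le_one mult_cancel_right1 abs_square_eq_1 power2_eq_square)
    have rf: "r = (+) ((b 0 - b k) *\<^sub>R e k) \<circ> f"
      by (auto simp: r_def f_def l_def fun_eq_iff algebra_simps)
    have "measure lebesgue (D 0) = measure lebesgue (f ` D k)"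
      by (simp only: im rf image_comp[symmetric] measure_translation)
    also have "\<dots> = measure lebesgue (D k)"
      using measure_lebesgue_linear_transformation[OF _ _ lf] Dm[of k] det
      by (metis mult_1 fmeasurableD measure_linear_image lf)
    finally show ?thesis by simp
  qed auto
  have "?B = (\<Union>k\<in>{..<m}. D k)"
  proof safe
    fix x assume x: "x \<in> K" "\<forall>j<m. 0 \<le> l j x"
    have "Max ((\<lambda>j. l j x) ` {..<m}) \<in> (\<lambda>j. l j x) ` {..<m}"
      using \<open>0 < m\<close> by (intro Max_in) auto
    then obtain k where "k < m" "Max ((\<lambda>j. l j x) ` {..<m}) = l k x" by auto
    then have "k < m" "\<forall>j<m. l j x \<le> l k x" by (auto simp flip: \<open>_ = l k x\<close>)
    then show "x \<in> (\<Union>k\<in>{..<m}. D k)" using x by (auto simp: D_def)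
  qed (auto simp: D_def)
  then have "measure lebesgue ?B = (\<Sum>k<m. measure lebesgue (D k))"
    using measure_negligible_finite_Union_image[of "{..<m}" D] Dm neg by simp
  also have "\<dots> = (\<Sum>k<m. measure lebesgue (D 0))" by (intro sum.cong refl eq) simp
  also have "\<dots> = real m * measure lebesgue (D 0)" by (simp only: sum_constant card_lessThan)
  finally show ?thesis .
qed

section \<open>Model corners of the unit tetrahedron and of a triangular prism\<close>

lemma forall_less_4: "(\<forall>j<4. P j) \<longleftrightarrow> P 0 \<and> P (Suc 0) \<and> P 2 \<and> P (3::nat)"
  by (simp add: numeral_eq_Suc less_Suc_eq) blast

lemma forall_less_3: "(\<forall>j<3. P j) \<longleftrightarrow> P 0 \<and> P (Suc 0) \<and> P (2::nat)"
  by (simp add: numeral_eq_Suc less_Suc_eq) blast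

lemma forall_less_2: "(\<forall>j<2. P j) \<longleftrightarrow> P 0 \<and> P (Suc (0::nat))"
  by (simp add: numeral_eq_Suc less_Suc_eq) blast

lemma inner_vector_3: "vector [p, q, r] \<bullet> (x::real^3) = p * x$1 + q * x$2 + r * x$3"
  by (simp add: inner_vec_def sum_3)

text \<open>The coordinates are the weights of three vertices of a tetrahedron and
  \<open>1 - x$1 - x$2 - x$3\<close> is the weight of the fourth, \<open>n\<close>: this is the
  region where \<open>n\<close> dominates, in coordinates.\<close>

definition simplex_corner :: "(real^3) set" where
  "simplex_corner = {x::real^3. (\<forall>i. 0 \<le> x$i) \<and> (\<forall>i. x$i \<le> 1 - x$1 - x$2 - x$3)}"
text \<open>Two coordinates are weights in a triangle, with \<open>1 - x$1 - x$2\<close> left for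
  \<open>n\<close>; the third is the height in the prism that \<open>planar_area\<close>
  measures.\<close>

definition prism_corner :: "(real^3) set" where
  "prism_corner = {x::real^3. 0 \<le> x$3 \<and> x$3 \<le> 1 \<and> 0 \<le> x$1 \<and> 0 \<le> x$2 \<and>
  x$1 \<le> 1 - x$1 - x$2 \<and> x$2 \<le> 1 - x$1 - x$2}"

text \<open>The standard simplex has volume 1/3!, and each of its four barycentric coordinates
  dominates on a quarter of it.\<close>

lemma measure_simplex_corner: "measure lebesgue simplex_corner = 1 / 24"
proof -
  \<comment> \<open>Index 0 is the weight of the origin, with constant term 1; the other indices are
    the coordinates. A move along an axis trades its coordinate against the weight of the
    origin.\<close>
  define a :: "nat \<Rightarrow> real^3" where "a k = ([vector [-1,-1,-1], vector [1,0,0], vector [0,1,0], vector [0,0,1]] ! k)" for k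
  define e :: "nat \<Rightarrow> real^3" where "e k = ([0, vector [1,0,0], vector [0,1,0], vector [0,0,1]] ! k)" for k
  define b :: "nat \<Rightarrow> real" where "b k = (if k = 0 then 1 else 0)" for k
  have a: "a 0 = vector [-1,-1,-1]" "a (Suc 0) = vector [1,0,0]" "a 2 = vector [0,1,0]" "a 3 = vector [0,0,1]"
   and e: "e (Suc 0) = vector [1,0,0]" "e 2 = vector [0,1,0]" "e 3 = vector [0,0,1]"
    by (auto simp: a_def e_def)
  have B: "Basis = {axis 1 1, axis 2 1, axis 3 (1::real) :: real^3}"
    by (auto simp: Basis_vec_def) (metis exhaust_3)
  have S: "{x\<in>UNIV. \<forall>j<4. 0 \<le> a j \<bullet> x + b j} = convex hull (insert 0 Basis)"
    unfolding std_simplex unfolding forall_less_4 a inner_vector_3 b_def B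
    by (auto simp: inner_axis axis_eq_axis)
  have "measure lebesgue {x\<in>UNIV. \<forall>j<4. 0 \<le> a j \<bullet> x + b j} =
    real 4 * measure lebesgue {x\<in>UNIV. \<forall>j<4. 0 \<le> a j \<bullet> x + b j \<and> a j \<bullet> x + b j \<le> a 0 \<bullet> x + b 0}"
  proof (rule measure_dominant_part[where e = e])
    have cs: "k = 1 \<or> k = 2 \<or> k = 3" if "0 < k" "k < 4" for k :: nat using that by auto
    show "a k \<bullet> e k = 1" "a 0 \<bullet> e k = -1" if "0 < k" "k < 4" for k
      using cs[OF that] by (auto simp: a e inner_vector_3)
    show "a j \<bullet> e k = 0" if "0 < k" "k < 4" "0 < j" "j < 4" "j \<noteq> k" for j k
      using cs[of k] cs[of j] that by (auto simp: a e inner_vector_3)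
    show "bounded {x\<in>UNIV. \<forall>j<4. 0 \<le> a j \<bullet> x + b j}"
      unfolding S by (intro bounded_convex_hull finite_imp_bounded) simp
  qed auto
  also have "{x\<in>UNIV. \<forall>j<4. 0 \<le> a j \<bullet> x + b j \<and> a j \<bullet> x + b j \<le> a 0 \<bullet> x + b 0} = simplex_corner"
    unfolding forall_less_4 a inner_vector_3 b_def simplex_corner_def by (auto simp: forall_3)
  finally show ?thesis
    unfolding S using content_std_simplex[where ?'a = "real^3"]
    by (simp add: measure_completion compact_imp_closed finite_imp_compact_convex_hull borel_closed fact_numeral)
qed

text \<open>Two applications of the exchange argument: the unit cube consists of two triangular
  prisms, and each vertex of the triangle dominates on a third of the prism.\<close>

lemma measure_prism_corner: "measure lebesgue prism_corner = 1 / 6"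
proof -
  define K :: "(real^3) set" where "K = cbox 0 (\<chi> i. 1)"
  have K: "x \<in> K \<longleftrightarrow> (\<forall>i. 0 \<le> x$i \<and> x$i \<le> 1)" for x by (auto simp: K_def mem_box_cart)
  have "measure lborel K = 1" unfolding K_def by (subst content_cbox_cart) (auto simp: interval_ne_empty_cart)
  \<comment> \<open>Comparing \<open>1 - x$2\<close> with \<open>x$1\<close> halves the cube along
    \<open>x$1 + x$2 = 1\<close>; the exchange along \<open>(1, 1, 0)\<close> is the reflection in
    that plane.\<close>
  define a :: "nat \<Rightarrow> real^3" where "a k = (if k = 0 then vector [0,-1,0] else vector [1,0,0])" for k
  define b :: "nat \<Rightarrow> real" where "b k = (if k = 0 then 1 else 0)" for k
  have "measure lebesgue {x\<in>K. \<forall>j<2. 0 \<le> a j \<bullet> x + b j} =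
    real 2 * measure lebesgue {x\<in>K. \<forall>j<2. 0 \<le> a j \<bullet> x + b j \<and> a j \<bullet> x + b j \<le> a 0 \<bullet> x + b 0}"
  proof (rule measure_dominant_part[where e = "\<lambda>_. vector [1,1,0]"])
    show "bounded {x\<in>K. \<forall>j<2. 0 \<le> a j \<bullet> x + b j}" by (rule bounded_subset[of K]) (auto simp: K_def)
  qed (auto simp: a_def b_def inner_vector_3 K forall_3, auto simp: K_def)
  moreover have "{x\<in>K. \<forall>j<2. 0 \<le> a j \<bullet> x + b j} = K"
    unfolding forall_less_2 by (auto simp: a_def b_def inner_vector_3 K)
  moreover have "{x\<in>K. \<forall>j<2. 0 \<le> a j \<bullet> x + b j \<and> a j \<bullet> x + b j \<le> a 0 \<bullet> x + b 0} =
    {x. 0 \<le> x$3 \<and> x$3 \<le> 1 \<and> 0 \<le> x$1 \<and> 0 \<le> x$2 \<and> x$1 + x$2 \<le> 1}" (is "_ = ?P")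
    unfolding forall_less_2 by (auto simp: a_def b_def inner_vector_3 K forall_3)
  ultimately have P: "measure lebesgue ?P = 1 / 2" using \<open>measure lborel K = 1\<close> by (simp add: K_def)
  \<comment> \<open>The height is kept out of the functionals by putting it into the ambient slab,
    so only the three triangle weights are exchanged.\<close>
  define K' :: "(real^3) set" where "K' = {x. 0 \<le> x$3 \<and> x$3 \<le> 1}"
  define a' :: "nat \<Rightarrow> real^3" where "a' k = ([vector [-1,-1,0], vector [1,0,0], vector [0,1,0]] ! k)" for k
  have a': "a' 0 = vector [-1,-1,0]" "a' (Suc 0) = vector [1,0,0]" "a' 2 = vector [0,1,0]"
    by (auto simp: a'_def)
  have S: "{x\<in>K'. \<forall>j<3. 0 \<le> a' j \<bullet> x + b j} = ?P"
    unfolding forall_less_3 a' by (auto simp: b_def inner_vector_3 K'_def)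
  have "measure lebesgue {x\<in>K'. \<forall>j<3. 0 \<le> a' j \<bullet> x + b j} =
    real 3 * measure lebesgue {x\<in>K'. \<forall>j<3. 0 \<le> a' j \<bullet> x + b j \<and> a' j \<bullet> x + b j \<le> a' 0 \<bullet> x + b 0}"
  proof (rule measure_dominant_part[where e = a'])
    have cs: "k = 1 \<or> k = 2" if "0 < k" "k < 3" for k :: nat using that by auto
    show "a' k \<bullet> a' k = 1" "a' 0 \<bullet> a' k = -1" if "0 < k" "k < 3" for k
      using cs[OF that] by (auto simp: a' inner_vector_3)
    show "a' j \<bullet> a' k = 0" if "0 < k" "k < 3" "0 < j" "j < 3" "j \<noteq> k" for j k
      using cs[of k] cs[of j] that by (auto simp: a' inner_vector_3)
    show "x + (a' 0 \<bullet> x + b 0 - (a' k \<bullet> x + b k)) *\<^sub>R a' k \<in> K'" if "0 < k" "k < 3" "x \<in> K'" for k x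
      using cs[of k] that by (auto simp: a' K'_def)
    show "bounded {x\<in>K'. \<forall>j<3. 0 \<le> a' j \<bullet> x + b j}"
      unfolding S by (rule bounded_subset[of K]) (auto simp: K forall_3, auto simp: K_def)
    show "closed K'" unfolding K'_def
      by (intro closed_Collect_conj closed_Collect_le continuous_intros)
  qed auto
  also have "{x\<in>K'. \<forall>j<3. 0 \<le> a' j \<bullet> x + b j \<and> a' j \<bullet> x + b j \<le> a' 0 \<bullet> x + b 0} = prism_corner"
    unfolding forall_less_3 a' by (auto simp: b_def inner_vector_3 K'_def prism_corner_def)
  finally show ?thesis unfolding S P by simp
qed

lemma measure_affine_frame_image:
  fixes S :: "(real^3) set"
  assumes "S \<in> lmeasurable" "bounded S"
  shows "measure lebesgue ((\<lambda>x. p + x$1 *\<^sub>R u + x$2 *\<^sub>R v + x$3 *\<^sub>R w) ` S) = \<bar>cross3 u v \<bullet> w\<bar> * measure lebesgue S"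
proof -
  define f :: "real^3 \<Rightarrow> real^3" where "f x = x$1 *\<^sub>R u + x$2 *\<^sub>R v + x$3 *\<^sub>R w" for x
  have "linear f" by (intro linearI) (auto simp: f_def algebra_simps)
  have "det (matrix f) = cross3 u v \<bullet> w"
    by (simp add: det_3 matrix_def f_def axis_def cross3_def inner_vec_def sum_3 algebra_simps)
  moreover have "(\<lambda>x. p + x$1 *\<^sub>R u + x$2 *\<^sub>R v + x$3 *\<^sub>R w) = (+) p \<circ> f"
    by (auto simp: f_def)
  ultimately show ?thesis
    using measure_lebesgue_linear_transformation[OF _ _ \<open>linear f\<close>] assms
    by (simp only: image_comp[symmetric] measure_translation fmeasurableD)
qed

subsection \<open>Faces of a simplex and the region where one barycentric coordinate dominates\<close>

text \<open>The vertex set is arbitrary, so that one notion describes the trace of the dual cell on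
  cells, faces and edges alike.\<close>

definition dominant_region :: "'a::real_vector \<Rightarrow> 'a set \<Rightarrow> 'a set" where
  "dominant_region n S =
     {\<Sum>v\<in>S. u v *\<^sub>R v | u. (\<forall>v\<in>S. 0 \<le> u v \<and> u v \<le> u n) \<and> sum u S = 1}"

lemma affine_independent_coeffs_unique:
  assumes "finite S" "\<not> affine_dependent S" "sum u S = sum w S"
    "(\<Sum>v\<in>S. u v *\<^sub>R v) = (\<Sum>v\<in>S. w v *\<^sub>R v)" "v \<in> S"
  shows "u v = w v"
proof (rule ccontr)
  assume "u v \<noteq> w v"
  then have "\<exists>U. sum U S = 0 \<and> (\<exists>v\<in>S. U v \<noteq> 0) \<and> (\<Sum>v\<in>S. U v *\<^sub>R v) = 0"
    using assms by (intro exI[of _ "\<lambda>v. u v - w v"])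
      (auto simp: sum_subtractf scaleR_diff_left)
  then show False using assms affine_dependent_explicit_finite by blast
qed

lemma dominant_region_subset_hull:
  "finite S \<Longrightarrow> dominant_region n S \<subseteq> convex hull S"
  by (auto simp: dominant_region_def convex_hull_finite)

text \<open>Weights on an affinely independent set are unique, so a point in the hull of
  \<open>F\<close> has weight 0 at the vertices outside \<open>F\<close>. Domination by
  \<open>n\<close> then means the same in \<open>S\<close> and in \<open>F\<close>.\<close>

lemma dominant_region_face:
  fixes S :: "'a::real_vector set"
  assumes S: "finite S" "\<not> affine_dependent S" and F: "F \<subseteq> S" "n \<in> F"
  shows "dominant_region n F = dominant_region n S \<inter> convex hull F"
proof safe
  have fF: "finite F" using S F finite_subset by blast
  have ext: "(\<Sum>v\<in>S. (if v \<in> F then u v else 0) *\<^sub>R v) = (\<Sum>v\<in>F. u v *\<^sub>R v)"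
    "(\<Sum>v\<in>S. if v \<in> F then u v else 0) = sum u F" for u :: "'a \<Rightarrow> real"
    using S F by (auto intro!: sum.mono_neutral_cong_right)
  fix x
  {
    assume "x \<in> dominant_region n F"
    then obtain u where u: "x = (\<Sum>v\<in>F. u v *\<^sub>R v)" "\<forall>v\<in>F. 0 \<le> u v \<and> u v \<le> u n" "sum u F = 1"
      by (auto simp: dominant_region_def)
    then show "x \<in> dominant_region n S" using F ext
      by (auto simp: dominant_region_def intro!: exI[of _ "\<lambda>v. if v \<in> F then u v else 0"])
    show "x \<in> convex hull F" using u by (auto simp: convex_hull_finite[OF fF])
  next
    assume "x \<in> dominant_region n S" "x \<in> convex hull F"
    then obtain u w where u: "x = (\<Sum>v\<in>S. u v *\<^sub>R v)" "\<forall>v\<in>S. 0 \<le> u v \<and> u v \<le> u n" "sum u S = 1"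
      and w: "x = (\<Sum>v\<in>F. w v *\<^sub>R v)" "sum w F = 1" "\<forall>v\<in>F. 0 \<le> w v"
      by (auto simp: dominant_region_def convex_hull_finite[OF fF])
    have "u v = (if v \<in> F then w v else 0)" if "v \<in> S" for v
      by (rule affine_independent_coeffs_unique[OF S _ _ that]) (use u w ext in auto)
    then have "\<forall>v\<in>F. w v \<le> w n" using F u(2) by (metis subsetD)
    then show "x \<in> dominant_region n F" using w by (auto simp: dominant_region_def)
  }
qed

lemma vertices_convex_hull:
  "\<not> affine_dependent S \<Longrightarrow> vertices (convex hull S) = S"
  by (auto simp: vertices_def extreme_point_of_convex_hull_affine_independent)

lemma barycenter_convex_hull:
  "\<not> affine_dependent S \<Longrightarrow> barycenter (convex hull S) = (\<Sum>v\<in>S. v) /\<^sub>R real (card S)"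
  by (simp add: barycenter_def vertices_convex_hull)

lemma convex_hull_affine_independent_inj:
  fixes S S' :: "point set"
  shows "\<not> affine_dependent S \<Longrightarrow> \<not> affine_dependent S' \<Longrightarrow> convex hull S = convex hull S' \<longleftrightarrow> S = S'"
  by (metis (mono_tags) vertices_convex_hull[of S] vertices_convex_hull[of S'])

lemma edge_of_convex_hull_affine_independent:
  fixes S :: "'a::euclidean_space set"
  assumes "\<not> affine_dependent S"
  shows "e edge_of convex hull S \<longleftrightarrow> (\<exists>x\<in>S. \<exists>y\<in>S. x \<noteq> y \<and> e = convex hull {x, y})"
proof -
  have "aff_dim (convex hull F) = 1 \<longleftrightarrow> (\<exists>x y. x \<noteq> y \<and> F = {x, y})" if "F \<subseteq> S" for F
  proof -
    have "\<not> affine_dependent F" using assms that affine_independent_subset by blast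
    then have "aff_dim (convex hull F) = 1 \<longleftrightarrow> card F = 2"
      using aff_dim_affine_independent[of F] by (auto simp: aff_dim_convex_hull)
    then show ?thesis by (auto simp: card_2_iff)
  qed
  then show ?thesis
    unfolding edge_of_def face_of_convex_hull_affine_independent[OF assms]
    by (metis (no_types, lifting) insert_subset empty_subsetI)
qed

lemma cross_dot_eq_det: "cross3 x y \<bullet> z = det (vector [x, y, z])"
  by (simp add: cross3_simps)

lemma mem_convex_hull_affine_independent:
  assumes "\<not> affine_dependent S" "F \<subseteq> S" "v \<in> S"
  shows "v \<in> convex hull F \<longleftrightarrow> v \<in> F"
proof
  assume v: "v \<in> convex hull F"
  show "v \<in> F"
  proof (rule ccontr)
    assume "v \<notin> F"
    then have "v \<in> convex hull (S - {v})" using v assms hull_mono[of F "S - {v}" convex] by blast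
    then show False using assms convex_hull_subset_affine_hull by (auto simp: affine_dependent_def)
  qed
qed (rule hull_inc)

lemma convex_hull_mono_affine_independent:
  assumes "\<not> affine_dependent S" "F \<subseteq> S" "G \<subseteq> S"
  shows "convex hull F \<subseteq> convex hull G \<longleftrightarrow> F \<subseteq> G"
  using mem_convex_hull_affine_independent[OF assms(1,3)] assms(2) hull_mono[of F G convex]
  by (meson hull_inc subset_iff)

text \<open>The cardinality makes the four points distinct; independence of the set alone would
  allow a repeated point.\<close>

locale tetrahedron =
  fixes n a b d :: point
  assumes independent: "\<not> affine_dependent {n, a, b, d}"
    and card: "card {n, a, b, d} = 4"
begin

lemma distinct: "n \<noteq> a" "n \<noteq> b" "n \<noteq> d" "a \<noteq> b" "a \<noteq> d" "b \<noteq> d"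
  using card by (auto simp: card_insert_if split: if_splits)

text \<open>Later facts single out the edge from \<open>n\<close> to \<open>a\<close> or the face
  spanned by \<open>n\<close>, \<open>a\<close>, \<open>b\<close>; the permutations that fix
  \<open>n\<close> carry them to the other edges and faces.\<close>

lemma swap:
  "tetrahedron n b a d" "tetrahedron n a d b" "tetrahedron n b d a" "tetrahedron n d a b" "tetrahedron n d b a"
  using independent card by (auto simp: tetrahedron_def insert_commute)

lemma det_nonzero: "cross3 (a - n) (b - n) \<bullet> (d - n) \<noteq> 0"
proof
  assume *: "cross3 (a - n) (b - n) \<bullet> (d - n) = 0"
  let ?A = "vector [a - n, b - n, d - n] :: real^3^3"
  have "det ?A = 0" using * by (simp only: cross_dot_eq_det)
  then have "\<not> invertible (transpose ?A)" by (simp only: invertible_det_nz det_transpose)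
  then obtain x where x: "transpose ?A *v x = 0" "x \<noteq> 0"
    by (metis invertible_left_inverse matrix_left_invertible_ker)
  then have 1: "x$1 *\<^sub>R (a - n) + x$2 *\<^sub>R (b - n) + x$3 *\<^sub>R (d - n) = 0"
    by (simp add: matrix_vector_mult_def transpose_def vec_eq_iff sum_3 forall_3 algebra_simps)
  \<comment> \<open>A linear relation between the three edge vectors becomes an affine dependence
    once \<open>n\<close> receives minus the sum of the other weights.\<close>
  define U where "U v = (if v = a then x$1 else if v = b then x$2 else if v = d then x$3
    else - x$1 - x$2 - x$3)" for v
  have U: "U a = x$1" "U b = x$2" "U d = x$3" "U n = - x$1 - x$2 - x$3"
    using distinct by (auto simp: U_def)
  have S: "sum f {n,a,b,d} = f n + f a + f b + f d" for f :: "point \<Rightarrow> 'b::comm_monoid_add"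
    using distinct by (simp add: add.assoc)
  have "sum U {n,a,b,d} = 0" unfolding S U by simp
  moreover have "(\<Sum>v\<in>{n,a,b,d}. U v *\<^sub>R v) = 0" unfolding S U using 1
    by (simp add: algebra_simps)
  moreover have "\<exists>v\<in>{n,a,b,d}. U v \<noteq> 0" using x(2) U by (auto simp: vec_eq_iff forall_3)
  ultimately have "\<exists>U. sum U {n,a,b,d} = 0 \<and> (\<exists>v\<in>{n,a,b,d}. U v \<noteq> 0) \<and> (\<Sum>v\<in>{n,a,b,d}. U v *\<^sub>R v) = 0"
    by blast
  then have "affine_dependent {n,a,b,d}"
    by (subst affine_dependent_explicit_finite) simp_all
  then show False using independent by simp
qed

lemma subset_independent: "F \<subseteq> {n, a, b, d} \<Longrightarrow> \<not> affine_dependent F"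
  using independent affine_independent_subset by blast

lemma facets:
  "f facet_of convex hull {n, a, b, d} \<longleftrightarrow>
     f \<in> {convex hull {n, a, b}, convex hull {n, a, d}, convex hull {n, b, d}, convex hull {a, b, d}}"
proof -
  have D: "{n, a, b, d} - {d} = {n, a, b}" "{n, a, b, d} - {b} = {n, a, d}"
    "{n, a, b, d} - {a} = {n, b, d}" "{n, a, b, d} - {n} = {a, b, d}"
    using distinct by auto
  have "(\<exists>u. u \<in> {n, a, b, d} \<and> f = convex hull ({n, a, b, d} - {u})) \<longleftrightarrow>
      f = convex hull ({n, a, b, d} - {n}) \<or> f = convex hull ({n, a, b, d} - {a}) \<or>
      f = convex hull ({n, a, b, d} - {b}) \<or> f = convex hull ({n, a, b, d} - {d})"
    by blast
  then show ?thesis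
    unfolding facet_of_convex_hull_affine_independent_alt[OF independent] card D by auto
qed

lemma facets_at:
  "{f. f facet_of convex hull {n, a, b, d} \<and> n \<in> f} =
     {convex hull {n, a, b}, convex hull {n, a, d}, convex hull {n, b, d}}"
proof -
  have "n \<notin> convex hull {a, b, d}"
    using mem_convex_hull_affine_independent[OF independent, of "{a, b, d}" n] distinct by auto
  moreover have "n \<in> convex hull (insert n F)" for F by (simp add: hull_inc)
  ultimately show ?thesis unfolding facets by blast
qed

lemma facets_containing_edge:
  "{f. f facet_of convex hull {n, a, b, d} \<and> convex hull {n, a} \<subseteq> f} =
     {convex hull {n, a, b}, convex hull {n, a, d}}"
proof -
  have "convex hull {n, a} \<subseteq> convex hull F \<longleftrightarrow> n \<in> F \<and> a \<in> F" if "F \<subseteq> {n, a, b, d}" for F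
    using convex_hull_mono_affine_independent[OF independent _ that, of "{n, a}"] by auto
  from this[of "{n, a, b}"] this[of "{n, a, d}"] this[of "{n, b, d}"] this[of "{a, b, d}"]
  show ?thesis unfolding facets using distinct by simp blast
qed

lemma edges_at:
  "{e. e edge_of convex hull {n, a, b, d} \<and> n \<in> e} =
     {convex hull {n, a}, convex hull {n, b}, convex hull {n, d}}"
proof -
  have *: "n \<in> convex hull {x, y} \<longleftrightarrow> n = x \<or> n = y" if "x \<in> {n, a, b, d}" "y \<in> {n, a, b, d}" for x y
    using mem_convex_hull_affine_independent[OF independent, of "{x, y}" n] that by auto
  have "e edge_of convex hull {n, a, b, d} \<and> n \<in> e \<longleftrightarrow> (\<exists>x\<in>{a, b, d}. e = convex hull {n, x})"
    (is "?L \<longleftrightarrow> ?R") for e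
  proof
    assume ?L
    then obtain x y where "x \<in> {n, a, b, d}" "y \<in> {n, a, b, d}" "x \<noteq> y" "e = convex hull {x, y}" "n \<in> e"
      unfolding edge_of_convex_hull_affine_independent[OF independent] by blast
    then show ?R using *[of x y] by (auto simp: insert_commute)
  next
    assume ?R
    then obtain x where "x \<in> {a, b, d}" "e = convex hull {n, x}" by blast
    then show ?L using distinct unfolding edge_of_convex_hull_affine_independent[OF independent]
      by (intro conjI bexI[of _ n] bexI[of _ x]) (auto simp: hull_inc)
  qed
  then show ?thesis by auto
qed

lemma barycenters:
  "barycenter (convex hull {n, a}) = (1/2) *\<^sub>R (n + a)"
  "barycenter (convex hull {n, a, b}) = (1/3) *\<^sub>R (n + a + b)"
  "barycenter (convex hull {n, a, b, d}) = (1/4) *\<^sub>R (n + a + b + d)"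
  using distinct
  by (simp_all add: barycenter_convex_hull subset_independent independent algebra_simps)

lemma dominant_region_eq:
  "dominant_region n {n, a, b, d} =
     (\<lambda>x. n + x$1 *\<^sub>R (a - n) + x$2 *\<^sub>R (b - n) + x$3 *\<^sub>R (d - n)) ` simplex_corner" (is "_ = ?f ` _")
proof safe
  have S: "sum f {n,a,b,d} = f n + f a + f b + f d" for f :: "point \<Rightarrow> 'b::comm_monoid_add"
    using distinct by (simp add: add.assoc)
  fix x
  {
    assume "x \<in> dominant_region n {n, a, b, d}"
    then obtain u where u: "x = (\<Sum>v\<in>{n,a,b,d}. u v *\<^sub>R v)" "\<forall>v\<in>{n,a,b,d}. 0 \<le> u v \<and> u v \<le> u n"
      and "sum u {n,a,b,d} = 1"
      unfolding dominant_region_def by blast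
    then have un: "u n = 1 - u a - u b - u d" using S[of u] by simp
    have "x = ?f (vector [u a, u b, u d])"
      unfolding u(1) S un by (simp add: algebra_simps)
    moreover have "vector [u a, u b, u d] \<in> simplex_corner"
      using u(2) un by (auto simp: simplex_corner_def forall_3)
    ultimately show "x \<in> ?f ` simplex_corner" by blast
  next
    fix x :: point assume x: "x \<in> simplex_corner"
    define u where "u v = (if v = a then x$1 else if v = b then x$2 else if v = d then x$3
      else 1 - x$1 - x$2 - x$3)" for v
    have U: "u a = x$1" "u b = x$2" "u d = x$3" "u n = 1 - x$1 - x$2 - x$3"
      using distinct by (auto simp: u_def)
    have "?f x = (\<Sum>v\<in>{n,a,b,d}. u v *\<^sub>R v)" unfolding S U by (simp add: algebra_simps)
    moreover have "sum u {n,a,b,d} = 1" unfolding S U by simp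
    moreover have "\<forall>v\<in>{n,a,b,d}. 0 \<le> u v \<and> u v \<le> u n"
      using x by (auto simp: U simplex_corner_def forall_3)
    ultimately show "?f x \<in> dominant_region n {n, a, b, d}"
      unfolding dominant_region_def by blast
  }
qed

end

subsection \<open>The dual cell inside a tetrahedron\<close>

text \<open>Summation by parts in the sorted barycentric coordinates: the hull weights are their
  successive differences, multiplied by 1, 2, 3, 4 because the corners are averages of 1, 2, 3, 4
  vertices.\<close>

lemma sorted_coeffs_mem_hull:
  fixes n p q r :: "real^'n"
  assumes "0 \<le> \<gamma>" "\<gamma> \<le> \<beta>" "\<beta> \<le> \<alpha>" "\<alpha> \<le> 1 - \<alpha> - \<beta> - \<gamma>"
  shows "n + \<alpha> *\<^sub>R (p - n) + \<beta> *\<^sub>R (q - n) + \<gamma> *\<^sub>R (r - n) \<in>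
    convex hull {n, (1/2) *\<^sub>R (n + p), (1/3) *\<^sub>R (n + p + q), (1/4) *\<^sub>R (n + p + q + r)}" (is "?x \<in> ?H")
proof -
  let ?w = "[1 - 2*\<alpha> - \<beta> - \<gamma>, 2*(\<alpha> - \<beta>), 3*(\<beta> - \<gamma>), 4*\<gamma>]"
  let ?y = "[n, (1/2) *\<^sub>R (n + p), (1/3) *\<^sub>R (n + p + q), (1/4) *\<^sub>R (n + p + q + r)]"
  have "(\<Sum>i<4. (?w ! i) *\<^sub>R (?y ! i)) \<in> ?H"
  proof (rule convex_sum)
    show "(\<Sum>i<4. ?w ! i) = 1" by (simp add: numeral_eq_Suc)
    fix i :: nat assume "i \<in> {..<4}"
    then have "i = 0 \<or> i = 1 \<or> i = 2 \<or> i = 3" by auto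
    then show "0 \<le> ?w ! i" "?y ! i \<in> ?H" using assms by (auto intro!: hull_inc)
  qed auto
  moreover have "(\<Sum>i<4. (?w ! i) *\<^sub>R (?y ! i)) = ?x"
  proof -
    have "(\<Sum>i<4. (?w ! i) *\<^sub>R (?y ! i)) = (1 - 2*\<alpha> - \<beta> - \<gamma>) *\<^sub>R n + (\<alpha> - \<beta>) *\<^sub>R (n + p) +
      (\<beta> - \<gamma>) *\<^sub>R (n + p + q) + \<gamma> *\<^sub>R (n + p + q + r)"
      by (simp add: numeral_eq_Suc diff_divide_distrib)
    also have "\<dots> = ?x"
      by (simp add: vec_eq_iff algebra_simps)
    finally show ?thesis .
  qed
  ultimately show ?thesis by simp
qed

lemma convex_simplex_corner: "convex simplex_corner"
proof -
  have "simplex_corner = (\<Inter>i. {x. 0 \<le> axis i 1 \<bullet> x} \<inter> {x. (axis i 1 + axis 1 1 + axis 2 1 + axis 3 1) \<bullet> x \<le> 1})"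
    by (auto simp: simplex_corner_def inner_axis' algebra_simps inner_add_left)
  also have "convex \<dots>" by (intro convex_INT convex_Int convex_halfspace_ge convex_halfspace_le)
  finally show ?thesis .
qed

lemma compact_simplex_corner: "compact simplex_corner"
proof -
  have "closed simplex_corner" unfolding simplex_corner_def
    by (intro closed_Collect_conj closed_Collect_all closed_Collect_le continuous_intros)
  moreover have "bounded simplex_corner"
    by (rule bounded_subset[of "cbox 0 (\<chi> i. 1)"])
      (auto simp: simplex_corner_def mem_box_cart forall_3)
  ultimately show ?thesis by (simp add: compact_eq_bounded_closed)
qed

lemma compact_prism_corner: "compact prism_corner"
proof -
  have "closed prism_corner" unfolding prism_corner_def
    by (intro closed_Collect_conj closed_Collect_all closed_Collect_le continuous_intros)
  moreover have "bounded prism_corner"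
    by (rule bounded_subset[of "cbox 0 (\<chi> i. 1)"])
      (auto simp: prism_corner_def mem_box_cart forall_3)
  ultimately show ?thesis by (simp add: compact_eq_bounded_closed)
qed

lemma linear_frame: "linear (\<lambda>x::real^3. x$1 *\<^sub>R u + x$2 *\<^sub>R v + x$3 *\<^sub>R (w::point))"
  by (intro linearI) (auto simp: algebra_simps)

context tetrahedron
begin

lemma convex_dominant_region: "convex (dominant_region n {n, a, b, d})"
  and compact_dominant_region: "compact (dominant_region n {n, a, b, d})"
proof -
  have "dominant_region n {n, a, b, d} =
      (+) n ` (\<lambda>x. x$1 *\<^sub>R (a - n) + x$2 *\<^sub>R (b - n) + x$3 *\<^sub>R (d - n)) ` simplex_corner"
    by (simp add: dominant_region_eq image_image add.assoc)
  then show "convex (dominant_region n {n, a, b, d})" "compact (dominant_region n {n, a, b, d})"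
    by (auto intro!: convex_translation convex_linear_image linear_frame convex_simplex_corner
        compact_translation compact_continuous_image compact_simplex_corner continuous_intros)
qed

lemma measure_dominant_region:
  "measure lebesgue (dominant_region n {n, a, b, d}) = \<bar>cross3 (a - n) (b - n) \<bullet> (d - n)\<bar> / 24"
  unfolding dominant_region_eq
  by (subst measure_affine_frame_image)
    (simp_all add: measure_simplex_corner lmeasurable_compact compact_simplex_corner compact_imp_bounded)

text \<open>By convexity only the corners matter; in the coordinates of
  \<open>simplex_corner\<close> they are (0, 0, 0), (1/2, 0, 0), (1/3, 1/3, 0) and (1/4, 1/4,
  1/4).\<close>

lemma flag_hull_subset_dominant_region:
  "convex hull {n, (1/2) *\<^sub>R (n + a), (1/3) *\<^sub>R (n + a + b), (1/4) *\<^sub>R (n + a + b + d)}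
     \<subseteq> dominant_region n {n, a, b, d}"
proof (rule hull_minimal)
  have *: "n + \<alpha> *\<^sub>R (a - n) + \<beta> *\<^sub>R (b - n) + \<gamma> *\<^sub>R (d - n) \<in> dominant_region n {n, a, b, d}"
    if "0 \<le> \<gamma>" "\<gamma> \<le> \<beta>" "\<beta> \<le> \<alpha>" "\<alpha> \<le> 1 - \<alpha> - \<beta> - \<gamma>" for \<alpha> \<beta> \<gamma>
    unfolding dominant_region_eq
    by (rule image_eqI[of _ _ "vector [\<alpha>, \<beta>, \<gamma>]"]) (use that in \<open>auto simp: simplex_corner_def forall_3\<close>)
  have "n \<in> dominant_region n {n, a, b, d}" using *[of 0 0 0] by simp
  moreover have "(1/2) *\<^sub>R (n + a) = n + (1/2) *\<^sub>R (a - n) + 0 *\<^sub>R (b - n) + 0 *\<^sub>R (d - n)"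
    "(1/3) *\<^sub>R (n + a + b) = n + (1/3) *\<^sub>R (a - n) + (1/3) *\<^sub>R (b - n) + 0 *\<^sub>R (d - n)"
    "(1/4) *\<^sub>R (n + a + b + d) = n + (1/4) *\<^sub>R (a - n) + (1/4) *\<^sub>R (b - n) + (1/4) *\<^sub>R (d - n)"
    by (simp_all add: vec_eq_iff algebra_simps)
  then have "(1/2) *\<^sub>R (n + a) \<in> dominant_region n {n, a, b, d}"
      "(1/3) *\<^sub>R (n + a + b) \<in> dominant_region n {n, a, b, d}"
      "(1/4) *\<^sub>R (n + a + b + d) \<in> dominant_region n {n, a, b, d}"
    using *[of 0 0 "1/2"] *[of 0 "1/3" "1/3"] *[of "1/4" "1/4" "1/4"] by simp_all
  ultimately show "{n, (1/2) *\<^sub>R (n + a), (1/3) *\<^sub>R (n + a + b), (1/4) *\<^sub>R (n + a + b + d)}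
     \<subseteq> dominant_region n {n, a, b, d}" by simp
qed (rule convex_dominant_region)

lemma flag_hull_subset_dual_cell_part:
  "convex hull {n, (1/2) *\<^sub>R (n + a), (1/3) *\<^sub>R (n + a + b), (1/4) *\<^sub>R (n + a + b + d)}
     \<subseteq> dual_cell_part n (convex hull {n, a, b, d})"
proof -
  let ?e = "convex hull {n, a}" and ?f = "convex hull {n, a, b}" and ?c = "convex hull {n, a, b, d}"
  have "?e edge_of ?c \<and> n \<in> ?e" using edges_at by blast
  moreover have "?f facet_of ?c" using facets_at by blast
  moreover have "?e \<subseteq> ?f" by (rule hull_mono) auto
  ultimately have "convex hull {n, barycenter ?e, barycenter ?f, barycenter ?c} \<subseteq> dual_cell_part n ?c"
    unfolding dual_cell_part_def by blast
  then show ?thesis unfolding barycenters .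
qed

text \<open>An edge at \<open>n\<close> inside a face amounts to an ordering of the other three
  vertices, so the six subdivision tetrahedra are one up to relabelling.\<close>

lemma flag_cases:
  assumes "e edge_of convex hull {n, a, b, d}" "f facet_of convex hull {n, a, b, d}" "n \<in> e" "e \<subseteq> f"
  obtains p q r where "tetrahedron n p q r" "{n, p, q, r} = {n, a, b, d}"
    "e = convex hull {n, p}" "f = convex hull {n, p, q}"
proof -
  have c: "convex hull {n, b, a, d} = convex hull {n, a, b, d}"
    "convex hull {n, d, a, b} = convex hull {n, a, b, d}" by (simp_all add: insert_commute)
  consider "e = convex hull {n, a}" | "e = convex hull {n, b}" | "e = convex hull {n, d}"
    using edges_at assms(1,3) by blast
  then show thesis
  proof cases
    case 1
    then have "f = convex hull {n, a, b} \<or> f = convex hull {n, a, d}"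
      using facets_containing_edge assms(2,4) by blast
    then show thesis using that[of a b d] that[of a d b] 1 swap tetrahedron_axioms
      by (auto simp: insert_commute)
  next
    case 2
    then have "f = convex hull {n, b, a} \<or> f = convex hull {n, b, d}"
      using tetrahedron.facets_containing_edge[OF swap(1)] assms(2,4) unfolding c by blast
    then show thesis using that[of b a d] that[of b d a] 2 swap
      by (auto simp: insert_commute)
  next
    case 3
    then have "f = convex hull {n, d, a} \<or> f = convex hull {n, d, b}"
      using tetrahedron.facets_containing_edge[OF swap(4)] assms(2,4) unfolding c by blast
    then show thesis using that[of d a b] that[of d b a] 3 swap
      by (auto simp: insert_commute)
  qed
qed

text \<open>The six subdivision tetrahedra are the pieces of the region on which the weights of
  \<open>a\<close>, \<open>b\<close>, \<open>d\<close> have a fixed order.\<close>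

lemma dual_cell_part_eq:
  "dual_cell_part n (convex hull {n, a, b, d}) = dominant_region n {n, a, b, d}"
proof
  show "dual_cell_part n (convex hull {n, a, b, d}) \<subseteq> dominant_region n {n, a, b, d}"
  proof
    fix x assume "x \<in> dual_cell_part n (convex hull {n, a, b, d})"
    then obtain e f where ef: "e edge_of convex hull {n, a, b, d}" "f facet_of convex hull {n, a, b, d}"
        "n \<in> e" "e \<subseteq> f"
      and x: "x \<in> convex hull {n, barycenter e, barycenter f, barycenter (convex hull {n, a, b, d})}"
      unfolding dual_cell_part_def by blast
    obtain p q r where t: "tetrahedron n p q r" and S: "{n, p, q, r} = {n, a, b, d}"
      and "e = convex hull {n, p}" "f = convex hull {n, p, q}"
      using flag_cases[OF ef] by blast
    then show "x \<in> dominant_region n {n, a, b, d}"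
      using x tetrahedron.flag_hull_subset_dominant_region[OF t] tetrahedron.barycenters[OF t]
      by auto
  qed
  show "dominant_region n {n, a, b, d} \<subseteq> dual_cell_part n (convex hull {n, a, b, d})"
  proof
    fix y assume "y \<in> dominant_region n {n, a, b, d}"
    then obtain \<alpha> \<beta> \<gamma> where y: "y = n + \<alpha> *\<^sub>R (a - n) + \<beta> *\<^sub>R (b - n) + \<gamma> *\<^sub>R (d - n)"
      and pos: "0 \<le> \<alpha>" "0 \<le> \<beta>" "0 \<le> \<gamma>"
      and le: "\<alpha> \<le> 1 - \<alpha> - \<beta> - \<gamma>" "\<beta> \<le> 1 - \<alpha> - \<beta> - \<gamma>" "\<gamma> \<le> 1 - \<alpha> - \<beta> - \<gamma>"
      unfolding dominant_region_eq by (auto simp: simplex_corner_def forall_3)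
    have *: "n + \<alpha>' *\<^sub>R (p - n) + \<beta>' *\<^sub>R (q - n) + \<gamma>' *\<^sub>R (r - n) \<in> dual_cell_part n (convex hull {n, a, b, d})"
      if "tetrahedron n p q r" "{n, p, q, r} = {n, a, b, d}"
        "0 \<le> \<gamma>'" "\<gamma>' \<le> \<beta>'" "\<beta>' \<le> \<alpha>'" "\<alpha>' \<le> 1 - \<alpha>' - \<beta>' - \<gamma>'" for p q r \<alpha>' \<beta>' \<gamma>'
      using sorted_coeffs_mem_hull[OF that(3-6), of n p q r]
        tetrahedron.flag_hull_subset_dual_cell_part[OF that(1)] that(2) by auto
    consider "\<gamma> \<le> \<beta>" "\<beta> \<le> \<alpha>" | "\<beta> \<le> \<gamma>" "\<gamma> \<le> \<alpha>" | "\<gamma> \<le> \<alpha>" "\<alpha> \<le> \<beta>" | "\<alpha> \<le> \<gamma>" "\<gamma> \<le> \<beta>"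
      | "\<beta> \<le> \<alpha>" "\<alpha> \<le> \<gamma>" | "\<alpha> \<le> \<beta>" "\<beta> \<le> \<gamma>" by linarith
    then show "y \<in> dual_cell_part n (convex hull {n, a, b, d})"
    proof cases
      case 1 show ?thesis using *[OF tetrahedron_axioms, of \<gamma> \<beta> \<alpha>] 1 pos le by (simp add: y)
    next
      case 2 show ?thesis using *[OF swap(2), of \<beta> \<gamma> \<alpha>] 2 pos le
        by (simp add: y algebra_simps insert_commute)
    next
      case 3 show ?thesis using *[OF swap(1), of \<gamma> \<alpha> \<beta>] 3 pos le
        by (simp add: y algebra_simps insert_commute)
    next
      case 4 show ?thesis using *[OF swap(3), of \<alpha> \<gamma> \<beta>] 4 pos le
        by (simp add: y algebra_simps insert_commute)
    next
      case 5 show ?thesis using *[OF swap(4), of \<beta> \<alpha> \<gamma>] 5 pos le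
        by (simp add: y algebra_simps insert_commute)
    next
      case 6 show ?thesis using *[OF swap(5), of \<alpha> \<beta> \<gamma>] 6 pos le
        by (simp add: y algebra_simps insert_commute)
    qed
  qed
qed

end

subsection \<open>Dual vectors of a tetrahedron\<close>

lemma outer_scaleR_left: "outer (r *\<^sub>R x) y = r *\<^sub>R outer x y"
  and outer_scaleR_right: "outer x (r *\<^sub>R y) = r *\<^sub>R outer x y"
  and outer_add_right: "outer x (y + z) = outer x y + outer x z"
  by (simp_all add: outer_def vec_eq_iff algebra_simps)

lemma outer_sum_right: "outer x (sum f I) = (\<Sum>i\<in>I. outer x (f i))"
  by (simp add: outer_def vec_eq_iff sum_distrib_left)

text \<open>This is A adj(A) = det(A) I for the matrix with columns \<open>p\<close>,
  \<open>q\<close>, \<open>r\<close>, whose adjugate has the cross products as rows; the second form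
  is the transpose.\<close>

lemma outer_cross_decomposition:
  "outer p (cross3 q r) + outer q (cross3 r p) + outer r (cross3 p q) = (cross3 p q \<bullet> r) *\<^sub>R mat 1"
  "outer (cross3 q r) p + outer (cross3 r p) q + outer (cross3 p q) r = (cross3 p q \<bullet> r) *\<^sub>R mat 1"
  by (simp_all add: outer_def mat_def cross3_def inner_vec_def sum_3 vec_eq_iff forall_3 algebra_simps)

lemma cross_eq_normal_component:
  assumes "norm u = 1" "u \<bullet> p = 0" "u \<bullet> q = 0"
  shows "cross3 p q = (cross3 p q \<bullet> u) *\<^sub>R u"
proof -
  \<comment> \<open>Both terms of the Lagrange formula vanish; applying \<open>cross3 u\<close> once
    more and expanding again splits off the component along \<open>u\<close>.\<close>
  have "cross3 u (cross3 p q) = 0" using assms by (simp add: Lagrange)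
  then have "cross3 u (cross3 u (cross3 p q)) = 0" by simp
  then show ?thesis using assms(1)
    by (simp add: Lagrange[of u u] inner_commute norm_eq_1)
qed

lemma sgn_eq_if_scaleR: "x \<noteq> 0 \<Longrightarrow> sgn x *\<^sub>R v = (if 0 < x then v else - v)" for x :: real and v :: "'a::real_vector"
  by (auto simp: sgn_if)

text \<open>Makes the sign selected in \<open>dual_edge_vec_part\<close> explicit, where
  \<open>u\<close> is the unit normal and \<open>r\<close> the area of the face.\<close>

lemma the_positive_multiple:
  fixes v u :: "'a::real_inner"
  assumes "v \<bullet> u \<noteq> 0" "0 < r"
  shows "(THE w. w \<in> {v, - v} \<and> w \<bullet> (r *\<^sub>R u) > 0) = sgn (v \<bullet> u) *\<^sub>R v"
  by (rule the_equality) (use assms in \<open>auto simp: zero_less_mult_iff sgn_eq_if_scaleR split: if_splits\<close>)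

context tetrahedron
begin

lemma dominant_region_triangle_eq:
  "dominant_region n {n, a, b} =
     {n + \<alpha> *\<^sub>R (a - n) + \<beta> *\<^sub>R (b - n) | \<alpha> \<beta>. 0 \<le> \<alpha> \<and> 0 \<le> \<beta> \<and> \<alpha> \<le> 1 - \<alpha> - \<beta> \<and> \<beta> \<le> 1 - \<alpha> - \<beta>}"
    (is "_ = ?R")
proof safe
  have S: "sum f {n,a,b} = f n + f a + f b" for f :: "point \<Rightarrow> 'b::comm_monoid_add"
    using distinct by (simp add: add.assoc)
  fix x
  {
    assume "x \<in> dominant_region n {n, a, b}"
    then obtain u where u: "x = (\<Sum>v\<in>{n,a,b}. u v *\<^sub>R v)" "\<forall>v\<in>{n,a,b}. 0 \<le> u v \<and> u v \<le> u n"
      and "sum u {n,a,b} = 1"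
      unfolding dominant_region_def by blast
    then have un: "u n = 1 - u a - u b" using S[of u] by simp
    have "x = n + u a *\<^sub>R (a - n) + u b *\<^sub>R (b - n)"
      unfolding u(1) S un by (simp add: algebra_simps)
    then show "\<exists>\<alpha> \<beta>. x = n + \<alpha> *\<^sub>R (a - n) + \<beta> *\<^sub>R (b - n) \<and>
        0 \<le> \<alpha> \<and> 0 \<le> \<beta> \<and> \<alpha> \<le> 1 - \<alpha> - \<beta> \<and> \<beta> \<le> 1 - \<alpha> - \<beta>"
      using u(2) un by (intro exI[of _ "u a"] exI[of _ "u b"]) auto
  next
    fix \<alpha> \<beta> :: real assume x: "0 \<le> \<alpha>" "0 \<le> \<beta>" "\<alpha> \<le> 1 - \<alpha> - \<beta>" "\<beta> \<le> 1 - \<alpha> - \<beta>"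
    define u where "u v = (if v = a then \<alpha> else if v = b then \<beta> else 1 - \<alpha> - \<beta>)" for v
    have U: "u a = \<alpha>" "u b = \<beta>" "u n = 1 - \<alpha> - \<beta>"
      using distinct by (auto simp: u_def)
    have "n + \<alpha> *\<^sub>R (a - n) + \<beta> *\<^sub>R (b - n) = (\<Sum>v\<in>{n,a,b}. u v *\<^sub>R v)"
      unfolding S U by (simp add: algebra_simps)
    moreover have "sum u {n,a,b} = 1" unfolding S U by simp
    moreover have "\<forall>v\<in>{n,a,b}. 0 \<le> u v \<and> u v \<le> u n" using x by (auto simp: U)
    ultimately show "n + \<alpha> *\<^sub>R (a - n) + \<beta> *\<^sub>R (b - n) \<in> dominant_region n {n, a, b}"
      unfolding dominant_region_def by blast
  }
qed

lemma prism_over_dominant_region: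
  "{x + t *\<^sub>R u | x t. x \<in> dominant_region n {n, a, b} \<and> 0 \<le> t \<and> t \<le> 1} =
     (\<lambda>x. n + x$1 *\<^sub>R (a - n) + x$2 *\<^sub>R (b - n) + x$3 *\<^sub>R u) ` prism_corner" (is "?L = ?f ` _")
proof safe
  fix x t assume "x \<in> dominant_region n {n, a, b}" and t: "0 \<le> t" "t \<le> (1::real)"
  then obtain \<alpha> \<beta> where x: "x = n + \<alpha> *\<^sub>R (a - n) + \<beta> *\<^sub>R (b - n)"
    and "0 \<le> \<alpha>" "0 \<le> \<beta>" "\<alpha> \<le> 1 - \<alpha> - \<beta>" "\<beta> \<le> 1 - \<alpha> - \<beta>"
    unfolding dominant_region_triangle_eq by blast
  then have "vector [\<alpha>, \<beta>, t] \<in> prism_corner" using t by (simp add: prism_corner_def)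
  moreover have "x + t *\<^sub>R u = ?f (vector [\<alpha>, \<beta>, t])" by (simp add: x)
  ultimately show "x + t *\<^sub>R u \<in> ?f ` prism_corner" by blast
next
  fix x :: point assume x: "x \<in> prism_corner"
  then have "n + x$1 *\<^sub>R (a - n) + x$2 *\<^sub>R (b - n) \<in> dominant_region n {n, a, b}"
    unfolding dominant_region_triangle_eq by (auto simp: prism_corner_def)
  then show "\<exists>y t. ?f x = y + t *\<^sub>R u \<and> y \<in> dominant_region n {n, a, b} \<and> 0 \<le> t \<and> t \<le> 1"
    using x by (auto simp: prism_corner_def)
qed

text \<open>The prism over the whole triangle has half the volume of the parallelepiped, and a third
  of that prism lies over the region.\<close>

lemma planar_area_dominant_region:
  "planar_area u (dominant_region n {n, a, b}) = \<bar>cross3 (a - n) (b - n) \<bullet> u\<bar> / 6"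
  unfolding planar_area_def prism_over_dominant_region
  by (subst measure_affine_frame_image)
    (simp_all add: measure_prism_corner lmeasurable_compact compact_prism_corner compact_imp_bounded)

text \<open>The triangle contains the dominant region, whose area is already known to be positive;
  monotonicity replaces a computation of the full area.\<close>

lemma planar_area_pos:
  assumes "cross3 (a - n) (b - n) \<bullet> u \<noteq> 0"
  shows "0 < planar_area u (convex hull {n, a, b})"
proof -
  let ?P = "\<lambda>S. {x + t *\<^sub>R u | x t. x \<in> S \<and> 0 \<le> t \<and> t \<le> 1}"
  have c: "compact (?P S)" if "compact S" for S
  proof -
    have "?P S = (\<lambda>p. fst p + snd p *\<^sub>R u) ` (S \<times> {0..1})" by force
    also have "compact \<dots>"
      by (intro compact_continuous_image compact_Times that continuous_intros) auto
    finally show ?thesis .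
  qed
  have "dominant_region n {n, a, b} \<subseteq> convex hull {n, a, b}"
    by (intro dominant_region_subset_hull) auto
  then have "?P (dominant_region n {n, a, b}) \<subseteq> ?P (convex hull {n, a, b})" by blast
  moreover have "?P (convex hull {n, a, b}) \<in> lmeasurable"
    by (intro lmeasurable_compact c finite_imp_compact_convex_hull) auto
  moreover have "?P (dominant_region n {n, a, b}) \<in> lmeasurable"
    unfolding prism_over_dominant_region
    by (intro lmeasurable_compact compact_continuous_image compact_prism_corner continuous_intros)
  ultimately have "planar_area u (dominant_region n {n, a, b}) \<le> planar_area u (convex hull {n, a, b})"
    unfolding planar_area_def by (intro measure_mono_fmeasurable) auto
  then show ?thesis using assms unfolding planar_area_dominant_region by auto
qed

lemma edge_point_eq: "edge_point n (convex hull {n, a}) = (3/4) *\<^sub>R n + (1/4) *\<^sub>R a"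
proof -
  have "{n, a} - {n} = {a}" using distinct by auto
  then show ?thesis by (simp add: edge_point_def vertices_convex_hull subset_independent)
qed

lemma face_point_eq: "face_point n (convex hull {n, a, b}) = (1/2) *\<^sub>R n + (1/4) *\<^sub>R a + (1/4) *\<^sub>R b"
proof -
  have "{n, a, b} - {n} = {a, b}" using distinct by auto
  then show ?thesis using distinct
    by (simp add: face_point_def vertices_convex_hull subset_independent)
qed

lemma barycenter_cell_minus_face:
  "barycenter (convex hull {n, a, b, d}) - barycenter (convex hull {n, a, b}) =
     (1/4) *\<^sub>R (d - n) - (1/12) *\<^sub>R ((a - n) + (b - n))"
  unfolding barycenters by (simp add: vec_eq_iff algebra_simps)

section \<open>Dual edge vectors and boundary segments at a face\<close>

context
  fixes \<nu> :: "point set \<Rightarrow> point"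
  assumes unit: "norm (\<nu> (convex hull {n, a, b})) = 1"
    and normal: "\<And>x y. x \<in> convex hull {n, a, b} \<Longrightarrow> y \<in> convex hull {n, a, b} \<Longrightarrow>
      \<nu> (convex hull {n, a, b}) \<bullet> (x - y) = 0"
begin

lemma normal_edges: "\<nu> (convex hull {n, a, b}) \<bullet> (a - n) = 0" "\<nu> (convex hull {n, a, b}) \<bullet> (b - n) = 0"
  by (auto intro!: normal hull_inc)

text \<open>Splits the orientation of the cell into two signs: how the chosen normal compares with
  the cross product, which enters the face vector, and on which side of the face the cell lies,
  which enters the dual edge vector.\<close>

lemma det_eq_normal_components:
  "cross3 (a - n) (b - n) \<bullet> (d - n) =
     (cross3 (a - n) (b - n) \<bullet> \<nu> (convex hull {n, a, b})) * (\<nu> (convex hull {n, a, b}) \<bullet> (d - n))"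
  by (subst cross_eq_normal_component[OF unit normal_edges]) simp

lemma normal_components_nonzero:
  "cross3 (a - n) (b - n) \<bullet> \<nu> (convex hull {n, a, b}) \<noteq> 0" "\<nu> (convex hull {n, a, b}) \<bullet> (d - n) \<noteq> 0"
  using det_nonzero det_eq_normal_components by auto

lemma barycenter_normal_component:
  "(barycenter (convex hull {n, a, b}) - barycenter (convex hull {n, a, b, d})) \<bullet> \<nu> (convex hull {n, a, b}) =
     - (\<nu> (convex hull {n, a, b}) \<bullet> (d - n)) / 4"
proof -
  have "(barycenter (convex hull {n, a, b, d}) - barycenter (convex hull {n, a, b})) \<bullet> \<nu> (convex hull {n, a, b}) =
     (\<nu> (convex hull {n, a, b}) \<bullet> (d - n)) / 4"
    unfolding barycenter_cell_minus_face
    by (simp only: inner_commute[of _ "\<nu> _"] inner_diff_right[of _ "(1/4) *\<^sub>R (d - n)"]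
        inner_add_right inner_scaleR_right normal_edges) simp
  then show ?thesis by (simp add: inner_diff_left)
qed

lemma dual_edge_vec_part_eq:
  "dual_edge_vec_part \<nu> (convex hull {n, a, b}) (convex hull {n, a, b, d}) =
     sgn ((barycenter (convex hull {n, a, b}) - barycenter (convex hull {n, a, b, d})) \<bullet> \<nu> (convex hull {n, a, b}))
       *\<^sub>R (barycenter (convex hull {n, a, b}) - barycenter (convex hull {n, a, b, d}))"
  (is "_ = sgn (?v \<bullet> ?\<nu>) *\<^sub>R _")
proof -
  have nz: "?v \<bullet> ?\<nu> \<noteq> 0" using barycenter_normal_component normal_components_nonzero by simp
  have "0 < planar_area ?\<nu> (convex hull {n, a, b})"
    by (rule planar_area_pos[OF normal_components_nonzero(1)])
  then show ?thesis
    unfolding dual_edge_vec_part_def face_vec_def by (rule the_positive_multiple[OF nz])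
qed

lemma bdry_edge_vec_part_eq:
  "bdry_edge_vec_part \<nu> n (convex hull {n, a, b}) (convex hull {n, a, b, d}) =
     sgn ((barycenter (convex hull {n, a, b}) - barycenter (convex hull {n, a, b, d})) \<bullet> \<nu> (convex hull {n, a, b}))
       *\<^sub>R (face_point n (convex hull {n, a, b}) - barycenter (convex hull {n, a, b}))"
  (is "_ = sgn (?v \<bullet> ?\<nu>) *\<^sub>R _")
proof -
  have nz: "?v \<bullet> ?\<nu> \<noteq> 0" using barycenter_normal_component normal_components_nonzero by simp
  \<comment> \<open>The test in the definition detects the sign because a nonzero vector differs
    from its negative.\<close>
  have "(if sgn r *\<^sub>R v = v then x - y else y - x) = sgn r *\<^sub>R (x - y)"
    if "r \<noteq> 0" "v \<noteq> 0" for r :: real and v x y :: point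
    using that by (auto simp: sgn_if vec_eq_iff)
  from this[OF nz] nz show ?thesis
    unfolding bdry_edge_vec_part_def dual_edge_vec_part_eq by (metis inner_zero_left)
qed

lemma outer_face_term:
  assumes "F = (\<bar>cross3 (a - n) (b - n) \<bullet> \<nu> (convex hull {n, a, b})\<bar> / 6) *\<^sub>R \<nu> (convex hull {n, a, b})"
  shows "outer F (dual_edge_vec_part \<nu> (convex hull {n, a, b}) (convex hull {n, a, b, d}) +
      bdry_edge_vec_part \<nu> n (convex hull {n, a, b}) (convex hull {n, a, b, d})) =
    (sgn (cross3 (a - n) (b - n) \<bullet> (d - n)) / 24) *\<^sub>R outer (cross3 (a - n) (b - n)) (d - n)"
proof -
  let ?x = "cross3 (a - n) (b - n) \<bullet> \<nu> (convex hull {n, a, b})"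
  let ?y = "\<nu> (convex hull {n, a, b}) \<bullet> (d - n)"
  have "F = (sgn ?x / 6) *\<^sub>R (?x *\<^sub>R \<nu> (convex hull {n, a, b}))"
    by (simp add: assms abs_sgn mult.commute)
  then have "F = (sgn ?x / 6) *\<^sub>R cross3 (a - n) (b - n)"
    unfolding cross_eq_normal_component[OF unit normal_edges, symmetric] .
  \<comment> \<open>The barycenter of the face drops out, and the minus sign of
    \<open>- (1/4) *\<^sub>R (d - n)\<close> cancels the one in
    \<open>barycenter_normal_component\<close>.\<close>
  moreover have "dual_edge_vec_part \<nu> (convex hull {n, a, b}) (convex hull {n, a, b, d}) +
      bdry_edge_vec_part \<nu> n (convex hull {n, a, b}) (convex hull {n, a, b, d}) = (sgn ?y / 4) *\<^sub>R (d - n)"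
    unfolding dual_edge_vec_part_eq bdry_edge_vec_part_eq barycenter_normal_component face_point_eq
    by (simp add: sgn_minus sgn_divide barycenters vec_eq_iff field_simps)
  ultimately show ?thesis
    unfolding det_eq_normal_components by (simp add: outer_scaleR_left outer_scaleR_right sgn_mult)
qed

end

section \<open>Dual face vectors and boundary triangles at an edge\<close>

context
  fixes oe :: "point set \<Rightarrow> point \<times> point" and s :: real
  assumes s: "s = 1 \<or> s = - 1" and edge_vec: "edge_vec oe (convex hull {n, a}) = s *\<^sub>R (a - n)"
begin

lemma dual_quad_vec_swap: "dual_quad_vec f2 f1 e c = - dual_quad_vec f1 f2 e c"
  by (simp add: dual_quad_vec_def cross3_simps)

lemma dual_quad_vec_eq:
  "dual_quad_vec (convex hull {n, a, b}) (convex hull {n, a, d}) (convex hull {n, a}) (convex hull {n, a, b, d}) =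
     (1/24) *\<^sub>R cross3 ((b - n) - (d - n)) ((a - n) - (b - n) - (d - n))"
proof -
  have "barycenter (convex hull {n, a, b}) - barycenter (convex hull {n, a, d}) =
      (1/3) *\<^sub>R ((b - n) - (d - n))"
    using barycenters(2) tetrahedron.barycenters(2)[OF swap(2)]
    by (simp add: vec_eq_iff algebra_simps)
  moreover have "barycenter (convex hull {n, a}) - barycenter (convex hull {n, a, b, d}) =
      (1/4) *\<^sub>R ((a - n) - (b - n) - (d - n))"
    unfolding barycenters by (simp add: vec_eq_iff algebra_simps)
  ultimately show ?thesis by (simp add: dual_quad_vec_def cross_mult_left cross_mult_right)
qed

text \<open>The sign of this product decides which order of the two faces
  \<open>ordered_faces\<close> selects.\<close>

lemma dual_quad_vec_inner:
  "dual_quad_vec (convex hull {n, a, b}) (convex hull {n, a, d}) (convex hull {n, a}) (convex hull {n, a, b, d})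
     \<bullet> edge_vec oe (convex hull {n, a}) = - s * (cross3 (a - n) (b - n) \<bullet> (d - n)) / 12"
proof -
  have *: "cross3 (q - r) (p - q - r) \<bullet> p = - 2 * (cross3 p q \<bullet> r)" for p q r :: point
    by (simp add: cross3_simps)
  show ?thesis unfolding dual_quad_vec_eq edge_vec inner_scaleR_left inner_scaleR_right * by simp
qed

lemma facets_at_edge_distinct: "convex hull {n, a, b} \<noteq> convex hull {n, a, d}"
  using distinct by (subst convex_hull_affine_independent_inj) (auto intro!: subset_independent)

lemma ordered_faces_eq:
  "ordered_faces oe (convex hull {n, a}) (convex hull {n, a, b, d}) =
     (if s * (cross3 (a - n) (b - n) \<bullet> (d - n)) < 0 then (convex hull {n, a, b}, convex hull {n, a, d})
      else (convex hull {n, a, d}, convex hull {n, a, b}))"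
proof -
  define g h where "g = convex hull {n, a, b}" and "h = convex hull {n, a, d}"
  let ?D = "s * (cross3 (a - n) (b - n) \<bullet> (d - n))"
  let ?P = "\<lambda>f1 f2. dual_quad_vec f1 f2 (convex hull {n, a}) (convex hull {n, a, b, d})
     \<bullet> edge_vec oe (convex hull {n, a}) > 0"
  \<comment> \<open>Nondegeneracy makes exactly one of the two orders positive, as the definite
    description requires.\<close>
  have "?D \<noteq> 0" using s det_nonzero by auto
  have P: "?P g h \<longleftrightarrow> ?D < 0" "?P h g \<longleftrightarrow> 0 < ?D"
    using dual_quad_vec_inner dual_quad_vec_swap[of h g] by (auto simp: g_def h_def)
  have "g \<noteq> h" using facets_at_edge_distinct by (simp add: g_def h_def)
  have *: "(case p of (f1, f2) \<Rightarrow> {g, h} = {f1, f2} \<and> ?P f1 f2) \<longleftrightarrow>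
      p = (if ?D < 0 then (g, h) else (h, g))" for p
    using P \<open>?D \<noteq> 0\<close> \<open>g \<noteq> h\<close> by (cases p) (auto simp: doubleton_eq_iff)
  show ?thesis
    unfolding ordered_faces_def facets_containing_edge g_def[symmetric] h_def[symmetric] *
    by simp
qed

text \<open>The two triangles share the side from the barycenter of the edge to
  \<open>edge_point\<close>, so their vectors merge into one cross product whose first factor is
  that of \<open>dual_quad_vec\<close>.\<close>

lemma bdry_face_vec_part_eq_if:
  "bdry_face_vec_part oe n (convex hull {n, a}) (convex hull {n, a, b, d}) =
     (if s * (cross3 (a - n) (b - n) \<bullet> (d - n)) < 0 then 1/2 else - 1/2) *\<^sub>R
       cross3 (barycenter (convex hull {n, a, b}) - barycenter (convex hull {n, a, d}))
         (edge_point n (convex hull {n, a}) - barycenter (convex hull {n, a}))"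
proof -
  have "(1/2) *\<^sub>R cross3 x y + (1/2) *\<^sub>R cross3 y z = (1/2) *\<^sub>R cross3 (x - z) y" for x y z :: point
    by (simp add: cross3_simps)
  note * = this[of "x - w" y "z - w" for x y z w, simplified]
  have sw: "- (1/2) *\<^sub>R cross3 (x - z) y = (1/2) *\<^sub>R cross3 (z - x) y" for x y z :: point
    by (simp add: cross3_simps)
  show ?thesis unfolding bdry_face_vec_part_def ordered_faces_eq using sw by (auto simp: *)
qed

lemma dual_plus_bdry_face_vec_part_eq:
  "dual_face_vec_part oe (convex hull {n, a}) (convex hull {n, a, b, d}) +
   bdry_face_vec_part oe n (convex hull {n, a}) (convex hull {n, a, b, d}) =
     (s * sgn (cross3 (a - n) (b - n) \<bullet> (d - n)) / 12) *\<^sub>R cross3 (b - n) (d - n)"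
proof -
  let ?D = "cross3 (a - n) (b - n) \<bullet> (d - n)"
  have 1: "barycenter (convex hull {n, a, b}) - barycenter (convex hull {n, a, d}) =
      (1/3) *\<^sub>R ((b - n) - (d - n))"
    using barycenters(2) tetrahedron.barycenters(2)[OF swap(2)]
    by (simp add: vec_eq_iff algebra_simps)
  have 2: "edge_point n (convex hull {n, a}) - barycenter (convex hull {n, a}) = - (1/4) *\<^sub>R (a - n)"
    unfolding barycenters edge_point_eq by (simp add: vec_eq_iff algebra_simps)
  have 3: "dual_face_vec_part oe (convex hull {n, a}) (convex hull {n, a, b, d}) =
     (if s * ?D < 0 then 1 else - 1) *\<^sub>R
     dual_quad_vec (convex hull {n, a, b}) (convex hull {n, a, d}) (convex hull {n, a}) (convex hull {n, a, b, d})"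
    unfolding dual_face_vec_part_def ordered_faces_eq
    using dual_quad_vec_swap[of "convex hull {n, a, d}" "convex hull {n, a, b}"] by auto
  \<comment> \<open>Both products reduce to the first factor \<open>q - r\<close> with weight 1/24;
    \<open>p\<close> cancels in the second factor, and \<open>cross3 (q - r) (q + r)\<close> is
    twice \<open>cross3 q r\<close>.\<close>
  have 4: "(1/24) *\<^sub>R cross3 (q - r) (p - q - r) + (1/2) *\<^sub>R cross3 ((1/3) *\<^sub>R (q - r)) (- (1/4) *\<^sub>R p) =
      - (1/12) *\<^sub>R cross3 q r" for p q r :: point
    by (simp add: vec_eq_iff forall_3 cross3_def field_simps)
  have "dual_face_vec_part oe (convex hull {n, a}) (convex hull {n, a, b, d}) +
     bdry_face_vec_part oe n (convex hull {n, a}) (convex hull {n, a, b, d}) =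
     (if s * ?D < 0 then 1 else - 1) *\<^sub>R (- (1/12)) *\<^sub>R cross3 (b - n) (d - n)"
    unfolding 3 bdry_face_vec_part_eq_if dual_quad_vec_eq 1 2 4[of "b - n" "d - n" "a - n", symmetric]
    by (simp add: algebra_simps)
  moreover have "(if s * ?D < 0 then 1 else - 1) = - (s * sgn ?D)"
    using s det_nonzero by (auto simp: sgn_if)
  ultimately show ?thesis by simp
qed

text \<open>Each face enters with a sign that depends only on the side of it on which the cell lies;
  this makes the contributions of two adjacent cells cancel.\<close>

lemma bdry_face_vec_part_eq:
  "bdry_face_vec_part oe n (convex hull {n, a}) (convex hull {n, a, b, d}) =
     (\<Sum>f | f facet_of convex hull {n, a, b, d} \<and> convex hull {n, a} \<subseteq> f.
       sgn (cross3 (edge_vec oe (convex hull {n, a})) (barycenter f - barycenter (convex hull {n, a})) \<bullet>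
            (barycenter (convex hull {n, a, b, d}) - barycenter f)) *\<^sub>R
       (- (1/2)) *\<^sub>R cross3 (barycenter f - barycenter (convex hull {n, a}))
         (edge_point n (convex hull {n, a}) - barycenter (convex hull {n, a})))"
proof -
  let ?D = "cross3 (a - n) (b - n) \<bullet> (d - n)"
  \<comment> \<open>The edge vector crossed with the vector from the barycenter of the edge to that
    of a face is a normal of the face that does not refer to the cell. Seen from the two faces
    through the edge, the cell lies on sides of opposite sign.\<close>
  have *: "cross3 (s *\<^sub>R p) ((1/3) *\<^sub>R q - (1/6) *\<^sub>R p) \<bullet> ((1/4) *\<^sub>R r - (1/12) *\<^sub>R (p + q)) =
      (s * (cross3 p q \<bullet> r)) / 12"
    "cross3 (s *\<^sub>R p) ((1/3) *\<^sub>R r - (1/6) *\<^sub>R p) \<bullet> ((1/4) *\<^sub>R q - (1/12) *\<^sub>R (p + r)) =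
      - (s * (cross3 p q \<bullet> r)) / 12" for p q r :: point
  proof -
    have c: "cross3 (s *\<^sub>R p) ((1/3) *\<^sub>R q - (1/6) *\<^sub>R p) = (s/3) *\<^sub>R cross3 p q" for q
      by (simp add: vec_eq_iff forall_3 cross3_def field_simps)
    have "cross3 p r \<bullet> q = - (cross3 p q \<bullet> r)" by (simp add: cross3_simps)
    then show "cross3 (s *\<^sub>R p) ((1/3) *\<^sub>R q - (1/6) *\<^sub>R p) \<bullet> ((1/4) *\<^sub>R r - (1/12) *\<^sub>R (p + q)) =
        (s * (cross3 p q \<bullet> r)) / 12"
      "cross3 (s *\<^sub>R p) ((1/3) *\<^sub>R r - (1/6) *\<^sub>R p) \<bullet> ((1/4) *\<^sub>R q - (1/12) *\<^sub>R (p + r)) =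
        - (s * (cross3 p q \<bullet> r)) / 12"
      unfolding c by (simp_all add: inner_diff_right inner_add_right dot_cross_self)
  qed
  have b: "barycenter (convex hull {n, a, b}) - barycenter (convex hull {n, a}) = (1/3) *\<^sub>R (b - n) - (1/6) *\<^sub>R (a - n)"
    unfolding barycenters by (simp add: vec_eq_iff algebra_simps)
  have d: "barycenter (convex hull {n, a, d}) - barycenter (convex hull {n, a}) = (1/3) *\<^sub>R (d - n) - (1/6) *\<^sub>R (a - n)"
    unfolding barycenters tetrahedron.barycenters(2)[OF swap(2)] by (simp add: vec_eq_iff algebra_simps)
  have c: "barycenter (convex hull {n, a, b, d}) - barycenter (convex hull {n, a, d}) =
      (1/4) *\<^sub>R (b - n) - (1/12) *\<^sub>R ((a - n) + (d - n))"
    using tetrahedron.barycenter_cell_minus_face[OF swap(2)] by (simp add: insert_commute)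
  have sg: "sgn (s * ?D) = (if s * ?D < 0 then - 1 else 1)"
    using s det_nonzero by (auto simp: sgn_if)
  have "x *\<^sub>R (- (1/2)) *\<^sub>R cross3 u w + - x *\<^sub>R (- (1/2)) *\<^sub>R cross3 v w = (- x / 2) *\<^sub>R cross3 (u - v) w"
    for x :: real and u v w :: point
    by (simp add: cross3_simps)
  from this[of "sgn (s * ?D)" "barycenter (convex hull {n, a, b}) - barycenter (convex hull {n, a})"
      "edge_point n (convex hull {n, a}) - barycenter (convex hull {n, a})"
      "barycenter (convex hull {n, a, d}) - barycenter (convex hull {n, a})"]
  have comb: "sgn (s * ?D / 12) *\<^sub>R (- (1/2)) *\<^sub>R cross3 (barycenter (convex hull {n, a, b}) - barycenter (convex hull {n, a}))
         (edge_point n (convex hull {n, a}) - barycenter (convex hull {n, a})) +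
     sgn (- (s * ?D) / 12) *\<^sub>R (- (1/2)) *\<^sub>R cross3 (barycenter (convex hull {n, a, d}) - barycenter (convex hull {n, a}))
         (edge_point n (convex hull {n, a}) - barycenter (convex hull {n, a})) =
     (- sgn (s * ?D) / 2) *\<^sub>R cross3 (barycenter (convex hull {n, a, b}) - barycenter (convex hull {n, a, d}))
         (edge_point n (convex hull {n, a}) - barycenter (convex hull {n, a}))"
    by (simp add: sgn_divide sgn_minus)
  have i1: "cross3 (edge_vec oe (convex hull {n, a})) (barycenter (convex hull {n, a, b}) - barycenter (convex hull {n, a})) \<bullet>
            (barycenter (convex hull {n, a, b, d}) - barycenter (convex hull {n, a, b})) = s * ?D / 12"
    unfolding edge_vec b barycenter_cell_minus_face by (rule *)
  have i2: "cross3 (edge_vec oe (convex hull {n, a})) (barycenter (convex hull {n, a, d}) - barycenter (convex hull {n, a})) \<bullet>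
            (barycenter (convex hull {n, a, b, d}) - barycenter (convex hull {n, a, d})) = - (s * ?D) / 12"
    unfolding edge_vec d c by (rule *)
  have sum2: "sum G {convex hull {n, a, b}, convex hull {n, a, d}} = G (convex hull {n, a, b}) + G (convex hull {n, a, d})"
    for G :: "point set \<Rightarrow> point"
    using facets_at_edge_distinct by simp
  show ?thesis
    unfolding facets_containing_edge bdry_face_vec_part_eq_if sum2 i1 i2 comb sg by simp
qed

end
end

subsection \<open>The identities for a single tetrahedron\<close>

lemma cross_dot_cyclic: "cross3 y z \<bullet> x = cross3 x y \<bullet> z"
  by (simp add: cross3_simps)

lemma dominant_region_segment:
  fixes n a :: point
  assumes "n \<noteq> a"
  shows "dominant_region n {n, a} = closed_segment n ((1/2) *\<^sub>R (n + a))"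
proof safe
  fix x
  {
    assume "x \<in> dominant_region n {n, a}"
    then obtain u where x: "x = u n *\<^sub>R n + u a *\<^sub>R a" "0 \<le> u a" "u a \<le> u n" "u n + u a = 1"
      using assms by (auto simp: dominant_region_def)
    then have un: "u n = 1 - u a" by simp
    have "x = (1 - 2 * u a) *\<^sub>R n + (2 * u a) *\<^sub>R ((1/2) *\<^sub>R (n + a))"
      unfolding x un by (simp add: vec_eq_iff algebra_simps)
    moreover have "0 \<le> 2 * u a" "2 * u a \<le> 1" using \<open>0 \<le> u a\<close> \<open>u a \<le> u n\<close> \<open>u n + u a = 1\<close> by auto
    ultimately show "x \<in> closed_segment n ((1/2) *\<^sub>R (n + a))" unfolding in_segment by blast
  next
    assume "x \<in> closed_segment n ((1/2) *\<^sub>R (n + a))"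
    then obtain t where t: "0 \<le> t" "t \<le> 1" and x: "x = (1 - t) *\<^sub>R n + t *\<^sub>R ((1/2) *\<^sub>R (n + a))"
      unfolding in_segment by blast
    have "x = (\<Sum>v\<in>{n, a}. (if v = n then 1 - t/2 else t/2) *\<^sub>R v)"
    proof -
      have "(\<Sum>v\<in>{n, a}. (if v = n then 1 - t/2 else t/2) *\<^sub>R v) = (1 - t/2) *\<^sub>R n + (t/2) *\<^sub>R a"
        using assms by auto
      also have "\<dots> = x" unfolding x by (simp add: vec_eq_iff algebra_simps)
      finally show ?thesis by simp
    qed
    then show "x \<in> dominant_region n {n, a}" unfolding dominant_region_def
      using assms t by (intro CollectI exI[of _ "\<lambda>v. if v = n then 1 - t/2 else t/2"]) auto
  }
qed

context tetrahedron
begin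

lemma outer_edge_term:
  assumes "edge_vec oe (convex hull {n, a}) = s *\<^sub>R (a - n)" "s = 1 \<or> s = - 1"
  shows "outer ((1/2) *\<^sub>R edge_vec oe (convex hull {n, a}))
      (dual_face_vec_part oe (convex hull {n, a}) (convex hull {n, a, b, d}) +
       bdry_face_vec_part oe n (convex hull {n, a}) (convex hull {n, a, b, d})) =
    (sgn (cross3 (a - n) (b - n) \<bullet> (d - n)) / 24) *\<^sub>R outer (a - n) (cross3 (b - n) (d - n))"
  using assms(2)
  unfolding dual_plus_bdry_face_vec_part_eq[OF assms(2,1)] assms(1)
  by (auto simp: outer_scaleR_left outer_scaleR_right)

lemma measure_dual_cell_part:
  "measure lebesgue (dual_cell_part n (convex hull {n, a, b, d})) =
     sgn (cross3 (a - n) (b - n) \<bullet> (d - n)) / 24 * (cross3 (a - n) (b - n) \<bullet> (d - n))"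
  unfolding dual_cell_part_eq measure_dominant_region by (simp add: abs_sgn)

text \<open>\<open>h\<close> stands for the edge vectors inside the dual cell, which depend on the
  whole mesh; only their values on the edges at \<open>n\<close> matter here. Cyclic relabelling of
  \<open>a\<close>, \<open>b\<close>, \<open>d\<close> moves each edge to the front and keeps the
  determinant, so the three terms share a factor.\<close>

lemma sum_outer_edge_terms:
  assumes "\<And>p. p \<in> {a, b, d} \<Longrightarrow> edge_vec oe (convex hull {n, p}) = p - n \<or> edge_vec oe (convex hull {n, p}) = n - p"
    and "\<And>p. p \<in> {a, b, d} \<Longrightarrow> h (convex hull {n, p}) = (1/2) *\<^sub>R edge_vec oe (convex hull {n, p})"
  shows "(\<Sum>e | e edge_of convex hull {n, a, b, d} \<and> n \<in> e.
      outer (h e) (dual_face_vec_part oe e (convex hull {n, a, b, d}) + bdry_face_vec_part oe n e (convex hull {n, a, b, d}))) =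
    measure lebesgue (dual_cell_part n (convex hull {n, a, b, d})) *\<^sub>R mat 1"
proof -
  let ?c = "convex hull {n, a, b, d}"
  let ?t = "\<lambda>p. outer (h (convex hull {n, p}))
     (dual_face_vec_part oe (convex hull {n, p}) ?c + bdry_face_vec_part oe n (convex hull {n, p}) ?c)"
  let ?D = "cross3 (a - n) (b - n) \<bullet> (d - n)"
  have sg: "\<exists>s. edge_vec oe (convex hull {n, p}) = s *\<^sub>R (p - n) \<and> (s = 1 \<or> s = - 1)" if "p \<in> {a, b, d}" for p
    using assms(1)[OF that] by (auto intro: exI[of _ 1] exI[of _ "-1"])
  have c: "convex hull {n, b, d, a} = ?c" "convex hull {n, d, a, b} = ?c" by (simp_all add: insert_commute)
  have t: "outer (h (convex hull {n, p})) (dual_face_vec_part oe (convex hull {n, p}) (convex hull {n, p, q, r}) +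
      bdry_face_vec_part oe n (convex hull {n, p}) (convex hull {n, p, q, r})) =
    (sgn (cross3 (p - n) (q - n) \<bullet> (r - n)) / 24) *\<^sub>R outer (p - n) (cross3 (q - n) (r - n))"
    if tet: "tetrahedron n p q r" and p: "p \<in> {a, b, d}" for p q r
  proof -
    obtain s where s: "edge_vec oe (convex hull {n, p}) = s *\<^sub>R (p - n)" "s = 1 \<or> s = - 1"
      using sg[OF p] by blast
    show ?thesis
      unfolding assms(2)[OF p] by (rule tetrahedron.outer_edge_term[OF tet s])
  qed
  have "?t a = (sgn ?D / 24) *\<^sub>R outer (a - n) (cross3 (b - n) (d - n))"
    by (rule t[OF tetrahedron_axioms]) simp
  moreover have "?t b = (sgn ?D / 24) *\<^sub>R outer (b - n) (cross3 (d - n) (a - n))"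
    using t[OF swap(3)] unfolding c cross_dot_cyclic[of "b - n" "d - n" "a - n"] by simp
  moreover have "?t d = (sgn ?D / 24) *\<^sub>R outer (d - n) (cross3 (a - n) (b - n))"
    using t[OF swap(4)] unfolding c cross_dot_cyclic[of "a - n" "b - n" "d - n", symmetric] by simp
  moreover have "inj_on (\<lambda>p. convex hull {n, p}) {a, b, d}"
  proof (rule inj_onI)
    fix x y assume "x \<in> {a, b, d}" "y \<in> {a, b, d}" and eq: "convex hull {n, x} = convex hull {n, y}"
    moreover from this have "\<not> affine_dependent {n, x}" "\<not> affine_dependent {n, y}"
      by (auto intro!: subset_independent)
    ultimately have "{n, x} = {n, y}" using convex_hull_affine_independent_inj by blast
    then show "x = y" by (auto simp: doubleton_eq_iff)
  qed
  then have "(\<Sum>e | e edge_of ?c \<and> n \<in> e. outer (h e) (dual_face_vec_part oe e ?c + bdry_face_vec_part oe n e ?c)) =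
      (\<Sum>p\<in>{a, b, d}. ?t p)"
    unfolding edges_at by (subst sum.reindex[symmetric, unfolded o_def]) simp_all
  moreover have "\<dots> = ?t a + ?t b + ?t d" using distinct by (simp add: add.assoc)
  ultimately show ?thesis
    unfolding measure_dual_cell_part by (simp add: outer_cross_decomposition flip: scaleR_add_right)
qed

text \<open>As for the edges, \<open>h\<close> is abstract and cyclic relabelling preserves the
  determinant; the cross product now comes from the face vector, so the transposed decomposition
  applies.\<close>

lemma sum_outer_face_terms:
  assumes unit: "\<And>f. f facet_of convex hull {n, a, b, d} \<Longrightarrow> norm (\<nu> f) = 1"
    and normal: "\<And>f x y. f facet_of convex hull {n, a, b, d} \<Longrightarrow> x \<in> f \<Longrightarrow> y \<in> f \<Longrightarrow> \<nu> f \<bullet> (x - y) = 0"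
    and h: "\<And>p q. p \<in> {a, b, d} \<Longrightarrow> q \<in> {a, b, d} \<Longrightarrow> p \<noteq> q \<Longrightarrow>
      h (convex hull {n, p, q}) = planar_area (\<nu> (convex hull {n, p, q})) (dominant_region n {n, p, q}) *\<^sub>R \<nu> (convex hull {n, p, q})"
  shows "(\<Sum>f | f facet_of convex hull {n, a, b, d} \<and> n \<in> f.
      outer (h f) (dual_edge_vec_part \<nu> f (convex hull {n, a, b, d}) + bdry_edge_vec_part \<nu> n f (convex hull {n, a, b, d}))) =
    measure lebesgue (dual_cell_part n (convex hull {n, a, b, d})) *\<^sub>R mat 1"
proof -
  let ?c = "convex hull {n, a, b, d}"
  let ?t = "\<lambda>f. outer (h f) (dual_edge_vec_part \<nu> f ?c + bdry_edge_vec_part \<nu> n f ?c)"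
  let ?D = "cross3 (a - n) (b - n) \<bullet> (d - n)"
  have c: "convex hull {n, b, d, a} = ?c" "convex hull {n, d, a, b} = ?c"
    "convex hull {n, d, a} = convex hull {n, a, d}" by (simp_all add: insert_commute)
  have t: "outer (h (convex hull {n, p, q})) (dual_edge_vec_part \<nu> (convex hull {n, p, q}) (convex hull {n, p, q, r}) +
      bdry_edge_vec_part \<nu> n (convex hull {n, p, q}) (convex hull {n, p, q, r})) =
    (sgn (cross3 (p - n) (q - n) \<bullet> (r - n)) / 24) *\<^sub>R outer (cross3 (p - n) (q - n)) (r - n)"
    if "tetrahedron n p q r" "{p, q} \<subseteq> {a, b, d}" "p \<noteq> q" "convex hull {n, p, q, r} = ?c" for p q r
  proof -
    have f: "convex hull {n, p, q} facet_of convex hull {n, a, b, d}"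
      using tetrahedron.facets_at[OF that(1)] unfolding that(4) by blast
    have hf: "h (convex hull {n, p, q}) = (\<bar>cross3 (p - n) (q - n) \<bullet> \<nu> (convex hull {n, p, q})\<bar> / 6) *\<^sub>R \<nu> (convex hull {n, p, q})"
      using h[of p q] that(2,3) unfolding tetrahedron.planar_area_dominant_region[OF that(1)] by simp
    show ?thesis
      by (rule tetrahedron.outer_face_term[where \<nu> = \<nu>, OF that(1)]) (use unit normal f hf in blast)+
  qed
  have "?t (convex hull {n, a, b}) = (sgn ?D / 24) *\<^sub>R outer (cross3 (a - n) (b - n)) (d - n)"
    using t[OF tetrahedron_axioms] distinct by auto
  moreover have "?t (convex hull {n, b, d}) = (sgn ?D / 24) *\<^sub>R outer (cross3 (b - n) (d - n)) (a - n)"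
    using t[OF swap(3)] distinct unfolding c cross_dot_cyclic[of "b - n" "d - n" "a - n"] by simp
  moreover have "?t (convex hull {n, a, d}) = (sgn ?D / 24) *\<^sub>R outer (cross3 (d - n) (a - n)) (b - n)"
    using t[OF swap(4)] distinct unfolding c cross_dot_cyclic[of "a - n" "b - n" "d - n", symmetric] by simp
  moreover have "{n, p, q} = {n, p', q'}"
    if "convex hull {n, p, q} = convex hull {n, p', q'}" "{p, q} \<subseteq> {a, b, d}" "{p', q'} \<subseteq> {a, b, d}" for p q p' q'
  proof -
    have "\<not> affine_dependent {n, p, q}" "\<not> affine_dependent {n, p', q'}"
      using that(2,3) by (auto intro!: subset_independent)
    then show ?thesis using that(1) convex_hull_affine_independent_inj by blast
  qed
  from this[of a b a d] this[of a b b d] this[of a d b d]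
  have "convex hull {n, a, b} \<noteq> convex hull {n, a, d}" "convex hull {n, a, b} \<noteq> convex hull {n, b, d}"
    "convex hull {n, a, d} \<noteq> convex hull {n, b, d}"
    using distinct by (auto simp: insert_eq_iff doubleton_eq_iff)
  then have "(\<Sum>f | f facet_of ?c \<and> n \<in> f. ?t f) =
      ?t (convex hull {n, a, b}) + ?t (convex hull {n, a, d}) + ?t (convex hull {n, b, d})"
    unfolding facets_at by (simp add: add.assoc)
  ultimately show ?thesis
    unfolding measure_dual_cell_part using outer_cross_decomposition(2)[where p = "a - n" and q = "b - n" and r = "d - n"]
    by (simp add: add.commute add.left_commute mult.commute flip: scaleR_add_right)
qed

end

subsection \<open>Adjacent cells of a mesh\<close>

locale tetrahedral_mesh =
  fixes \<T> :: "point set set"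
  assumes triangulation: "triangulation \<T>" and simplex: "\<And>c. c \<in> \<T> \<Longrightarrow> 3 simplex c"
begin

lemma finite_cells: "finite \<T>"
  and Int_face_of: "c \<in> \<T> \<Longrightarrow> c' \<in> \<T> \<Longrightarrow> (c \<inter> c') face_of c"
  using triangulation by (auto simp: triangulation_def)

text \<open>By conformity the intersection of the two cells is a face of both, and \<open>s\<close>
  is a face of that intersection. This justifies expressing incidence by inclusion.\<close>

lemma face_of_other_cell:
  assumes "s face_of c" "c \<in> \<T>" "c' \<in> \<T>" "s \<subseteq> c'"
  shows "s face_of c'"
proof -
  have "s face_of c \<inter> c'"
    using assms face_of_imp_subset by (intro face_of_subset[OF assms(1)]) auto
  moreover have "(c \<inter> c') face_of c'" using Int_face_of[of c' c] assms by (simp add: Int_commute)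
  ultimately show ?thesis by (rule face_of_trans)
qed

lemma aff_dim_cell: "c \<in> \<T> \<Longrightarrow> aff_dim c = 3"
  using simplex aff_dim_simplex by blast

lemma edge_of_cell_iff: "e \<in> grid_edges \<T> \<Longrightarrow> c \<in> \<T> \<Longrightarrow> e edge_of c \<longleftrightarrow> e \<subseteq> c"
  by (auto simp: grid_edges_def edge_of_def dest: face_of_imp_subset intro: face_of_other_cell)

lemma facet_of_cell_iff: "f \<in> grid_faces \<T> \<Longrightarrow> c \<in> \<T> \<Longrightarrow> f facet_of c \<longleftrightarrow> f \<subseteq> c"
  by (auto simp: grid_faces_def facet_of_def aff_dim_cell dest: face_of_imp_subset intro: face_of_other_cell)

lemma cell_hull:
  assumes "c \<in> \<T>"
  obtains S where "card S = 4" "\<not> affine_dependent S" "c = convex hull S"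
  using simplex[OF assms] by (auto simp: simplex_def)

lemma cell_tetrahedron:
  assumes "c \<in> \<T>" "v \<in> vertices c"
  obtains a b d where "tetrahedron v a b d" "c = convex hull {v, a, b, d}"
proof -
  obtain S where S: "card S = 4" "\<not> affine_dependent S" "c = convex hull S"
    using cell_hull[OF assms(1)] .
  then have "v \<in> S" using assms(2) by (simp add: vertices_convex_hull)
  then have "card (S - {v}) = 3" using S(1) by simp
  then obtain a b d where "S - {v} = {a, b, d}" by (auto simp: card_3_iff)
  then have "S = {v, a, b, d}" using \<open>v \<in> S\<close> by blast
  then show thesis using that[of a b d] S by (simp add: tetrahedron_def)
qed

lemma facet_tetrahedron:
  assumes "c \<in> \<T>" "f facet_of c"
  obtains p q r d where "tetrahedron p q r d" "c = convex hull {p, q, r, d}" "f = convex hull {p, q, r}"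
proof -
  obtain S where S: "card S = 4" "\<not> affine_dependent S" "c = convex hull S"
    using cell_hull[OF assms(1)] .
  then obtain d where d: "d \<in> S" "f = convex hull (S - {d})"
    using assms(2) by (auto simp: facet_of_convex_hull_affine_independent)
  then have "card (S - {d}) = 3" using S(1) by simp
  then obtain p q r where pqr: "S - {d} = {p, q, r}" by (auto simp: card_3_iff)
  then have "S = {p, q, r, d}" using d(1) by blast
  then show thesis using that[of p q r d] S d(2) pqr by (simp add: tetrahedron_def)
qed

text \<open>A hull of independent points determines them, so cells at a common facet can be labelled
  to differ only in the opposite vertex.\<close>

lemma same_facet_tetrahedron:
  assumes "tetrahedron p q r d" "f = convex hull {p, q, r}" "c \<in> \<T>" "f facet_of c"
  obtains d' where "tetrahedron p q r d'" "c = convex hull {p, q, r, d'}"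
proof -
  obtain p' q' r' d' where t: "tetrahedron p' q' r' d'" "c = convex hull {p', q', r', d'}"
    "f = convex hull {p', q', r'}"
    using facet_tetrahedron[OF assms(3,4)] .
  have "\<not> affine_dependent {p, q, r}" "\<not> affine_dependent {p', q', r'}"
    using tetrahedron.subset_independent[OF assms(1), of "{p, q, r}"]
      tetrahedron.subset_independent[OF t(1), of "{p', q', r'}"] by auto
  then have "{p, q, r} = {p', q', r'}"
    using assms(2) t(3) convex_hull_affine_independent_inj by blast
  then have "{p, q, r, d'} = {p', q', r', d'}" by (metis insert_commute)
  then show thesis using that[of d'] t by (simp add: tetrahedron_def)
qed

lemma cells_containing_facets:
  "f \<in> grid_faces \<T> \<Longrightarrow> cells_containing \<T> f = {c \<in> \<T>. f facet_of c}"
  by (auto simp: cells_containing_def facet_of_cell_iff)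

text \<open>Lets the side on which a cell lies be read off from its vertex opposite to the
  face.\<close>

lemma normal_barycenter_difference:
  assumes "tetrahedron p q r d"
    and w: "\<And>x y. x \<in> convex hull {p, q, r} \<Longrightarrow> y \<in> convex hull {p, q, r} \<Longrightarrow> w \<bullet> (x - y) = 0"
  shows "w \<bullet> (barycenter (convex hull {p, q, r, d}) - barycenter (convex hull {p, q, r})) = w \<bullet> (d - p) / 4"
proof -
  have "w \<bullet> (q - p) = 0" "w \<bullet> (r - p) = 0" by (auto intro!: w hull_inc)
  then show ?thesis
    unfolding tetrahedron.barycenter_cell_minus_face[OF assms(1)]
    by (simp only: inner_diff_right[of w "(1/4) *\<^sub>R (d - p)"] inner_add_right inner_scaleR_right) simp
qed

lemma barycenter_in_rel_interior:
  assumes "f \<in> grid_faces \<T>"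
  shows "barycenter f \<in> rel_interior f"
proof -
  obtain c where "c \<in> \<T>" "f facet_of c" using assms by (auto simp: grid_faces_def)
  then obtain p q r d where t: "tetrahedron p q r d" "f = convex hull {p, q, r}"
    by (rule facet_tetrahedron)
  have ind: "\<not> affine_dependent {p, q, r}" by (rule tetrahedron.subset_independent[OF t(1)]) auto
  show ?thesis
    unfolding t(2) rel_interior_convex_hull_explicit[OF ind] tetrahedron.barycenters(2)[OF t(1)]
    using tetrahedron.distinct[OF t(1)]
    by (intro CollectI exI[of _ "\<lambda>_. 1/3"]) (auto simp: algebra_simps)
qed

text \<open>A short step from the barycenter of \<open>f\<close> in direction \<open>w\<close> stays
  in the union and avoids the cells that miss the barycenter, so it ends in a cell containing both
  points; that cell is the one sought.\<close>

lemma cell_on_positive_side: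
  assumes f: "f \<in> grid_faces \<T>" and b: "barycenter f \<in> interior (\<Union>\<T>)"
    and w: "w \<noteq> 0" "\<And>x y. x \<in> f \<Longrightarrow> y \<in> f \<Longrightarrow> w \<bullet> (x - y) = 0"
  shows "\<exists>c\<in>cells_containing \<T> f. 0 < w \<bullet> (barycenter c - barycenter f)"
proof -
  let ?b = "barycenter f"
  obtain c0 where c0: "c0 \<in> \<T>" "f facet_of c0" using f by (auto simp: grid_faces_def)
  then obtain p q r d0 where t: "tetrahedron p q r d0" "c0 = convex hull {p, q, r, d0}" "f = convex hull {p, q, r}"
    by (rule facet_tetrahedron)
  have rel: "?b \<in> rel_interior f" by (rule barycenter_in_rel_interior[OF f])
  \<comment> \<open>A finite union of closed cells, so its complement is a neighbourhood of the
    barycenter.\<close>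
  define U where "U = \<Union>{c\<in>\<T>. ?b \<notin> c}"
  have "closed c" if "c \<in> \<T>" for c
    using cell_hull[OF that] by (metis aff_independent_finite finite_imp_compact_convex_hull compact_imp_closed)
  then have "closed U" unfolding U_def using finite_cells by (intro closed_Union) auto
  then have "open (interior (\<Union>\<T>) - U)" by (intro open_Diff) auto
  moreover have "?b \<in> interior (\<Union>\<T>) - U" using b by (auto simp: U_def)
  ultimately obtain \<epsilon> where \<epsilon>: "0 < \<epsilon>" "cball ?b \<epsilon> \<subseteq> interior (\<Union>\<T>) - U"
    using open_contains_cball by blast
  define t where "t = \<epsilon> / norm w"
  have "0 < t" using w(1) \<epsilon>(1) by (simp add: t_def)
  let ?x = "?b + t *\<^sub>R w"
  have "?x \<in> cball ?b \<epsilon>" using w(1) \<epsilon>(1) by (simp add: t_def dist_norm)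
  then have "?x \<in> \<Union>\<T>" "?x \<notin> U" using \<epsilon>(2) interior_subset by blast+
  then obtain c where c: "c \<in> \<T>" "?x \<in> c" "?b \<in> c" by (auto simp: U_def)
  \<comment> \<open>A face of \<open>c0\<close> that meets the relative interior of \<open>f\<close>
    contains all of \<open>f\<close>; the barycenter is such a meeting point.\<close>
  have "f \<subseteq> c0 \<inter> c"
  proof (rule subset_of_face_of)
    show "(c0 \<inter> c) face_of c0" using Int_face_of c0 c by blast
    show "f \<subseteq> c0" using c0(2) facet_of_imp_subset by blast
    show "(c0 \<inter> c) \<inter> rel_interior f \<noteq> {}"
      using rel c(3) c0(2) facet_of_imp_subset rel_interior_subset by blast
  qed
  then have fc: "f facet_of c" and cc: "c \<in> cells_containing \<T> f"
    using facet_of_cell_iff[OF f c(1)] c(1) by (auto simp: cells_containing_def)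
  obtain d where d: "tetrahedron p q r d" "c = convex hull {p, q, r, d}"
    using same_facet_tetrahedron[OF t(1,3) c(1) fc] .
  have wb: "w \<bullet> v = w \<bullet> ?b" if "v \<in> f" for v
    using w(2)[OF that, of ?b] rel rel_interior_subset by (auto simp: inner_diff_right)
  \<comment> \<open>Otherwise all vertices of \<open>c\<close>, hence \<open>c\<close> itself, would
    lie in the closed half-space behind \<open>f\<close>, which \<open>?x\<close> has left.\<close>
  have "0 < w \<bullet> (d - p)"
  proof (rule ccontr)
    assume "\<not> 0 < w \<bullet> (d - p)"
    then have "{p, q, r, d} \<subseteq> {y. w \<bullet> y \<le> w \<bullet> ?b}"
      using wb[of p] wb[of q] wb[of r] by (auto simp: t(3) hull_inc inner_diff_right)
    then have "c \<subseteq> {y. w \<bullet> y \<le> w \<bullet> ?b}"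
      unfolding d(2) by (intro hull_minimal convex_halfspace_le)
    then have "t * (w \<bullet> w) \<le> 0" using c(2) by (auto simp: inner_add_right)
    then show False using \<open>0 < t\<close> w(1) inner_gt_zero_iff[of w] by (auto simp: mult_le_0_iff simp del: inner_gt_zero_iff)
  qed
  then have "0 < w \<bullet> (barycenter c - ?b)"
    using normal_barycenter_difference[OF d(1), of w, OF w(2)[unfolded t(3)]] unfolding t(3) d(2) by simp
  then show ?thesis using cc by blast
qed

text \<open>Two cells on the same side of \<open>f\<close> overlap near its barycenter: moving
  slightly from there towards the apex \<open>d\<close> of \<open>c\<close> leads into the relative
  interior of \<open>c'\<close>. Conformity then forces the cells to coincide.\<close>

lemma cell_on_positive_side_unique:
  assumes f: "f \<in> grid_faces \<T>"
    and w: "\<And>x y. x \<in> f \<Longrightarrow> y \<in> f \<Longrightarrow> w \<bullet> (x - y) = 0"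
    and c: "c \<in> cells_containing \<T> f" "0 < w \<bullet> (barycenter c - barycenter f)"
    and c': "c' \<in> cells_containing \<T> f" "0 < w \<bullet> (barycenter c' - barycenter f)"
  shows "c = c'"
proof -
  let ?b = "barycenter f"
  have cT: "c \<in> \<T>" "f facet_of c" "c' \<in> \<T>" "f facet_of c'"
    using c(1) c'(1) f by (auto simp: cells_containing_facets)
  obtain p q r d where t: "tetrahedron p q r d" "c = convex hull {p, q, r, d}" "f = convex hull {p, q, r}"
    using facet_tetrahedron[OF cT(1,2)] .
  obtain d' where t': "tetrahedron p q r d'" "c' = convex hull {p, q, r, d'}"
    using same_facet_tetrahedron[OF t(1,3) cT(3,4)] .
  have pos: "0 < w \<bullet> (d - p)" "0 < w \<bullet> (d' - p)"
    using c(2) c'(2) normal_barycenter_difference[OF t(1), of w, OF w[unfolded t(3)]]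
      normal_barycenter_difference[OF t'(1), of w, OF w[unfolded t(3)]]
    unfolding t(2,3) t'(2) by simp_all
  have S: "sum g {p, q, r, d'} = g p + g q + g r + g d'" for g :: "point \<Rightarrow> 'b::comm_monoid_add"
    using tetrahedron.distinct[OF t'(1)] by (simp add: add.assoc)
  have "affine hull {p, q, r, d'} = UNIV"
    using tetrahedron.independent[OF t'(1)] tetrahedron.card[OF t'(1)]
    by (intro affine_independent_span_eq) auto
  then have "d \<in> affine hull {p, q, r, d'}" by simp
  then obtain u where u: "sum u {p, q, r, d'} = 1" "(\<Sum>v\<in>{p, q, r, d'}. u v *\<^sub>R v) = d"
    by (auto simp: affine_hull_finite)
  have up: "u p = 1 - u q - u r - u d'" using u(1) unfolding S by simp
  have "d - p = u q *\<^sub>R (q - p) + u r *\<^sub>R (r - p) + u d' *\<^sub>R (d' - p)"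
    unfolding u(2)[symmetric] S up by (simp add: algebra_simps)
  moreover have "w \<bullet> (q - p) = 0" "w \<bullet> (r - p) = 0" using w by (auto simp: t(3) hull_inc)
  \<comment> \<open>Pairing with \<open>w\<close> removes the directions in the plane of
    \<open>f\<close>, so the \<open>d'\<close>-coordinate of \<open>d\<close> is a quotient of two
    positive numbers.\<close>
  ultimately have "w \<bullet> (d - p) = u d' * (w \<bullet> (d' - p))"
    by (simp only: inner_add_right inner_scaleR_right mult_zero_right add_0)
  then have "0 < u d'" using pos by (simp add: zero_less_mult_iff)
  \<comment> \<open>\<open>M\<close> bounds the coordinates of \<open>d\<close> at \<open>p\<close>,
    \<open>q\<close>, \<open>r\<close>. With step size \<open>1 / (6 * M)\<close> they shift the
    weights by at most 1/6, while \<open>(1 - s) / 3\<close> is at least 5/18, so all weights stay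
    positive.\<close>
  define M where "M = 1 + \<bar>u p\<bar> + \<bar>u q\<bar> + \<bar>u r\<bar>"
  define s where "s = 1 / (6 * M)"
  have "1 \<le> M" by (simp add: M_def)
  then have s: "0 < s" "s \<le> 1/6" by (auto simp: s_def field_simps)
  have small: "0 < (1 - s) / 3 + s * u v" if "\<bar>u v\<bar> \<le> M" for v
  proof -
    have "s * \<bar>u v\<bar> \<le> s * M" using that s by (intro mult_left_mono) auto
    also have "s * M = 1/6" using \<open>1 \<le> M\<close> by (simp add: s_def)
    finally have "\<bar>s * u v\<bar> \<le> 1/6" using s by (simp add: abs_mult)
    then show ?thesis using s by (simp add: abs_le_iff field_simps)
  qed
  let ?x = "(1 - s) *\<^sub>R ?b + s *\<^sub>R d"
  have bf: "?b = (1/3) *\<^sub>R (p + q + r)" unfolding t(3) by (rule tetrahedron.barycenters(2)[OF t(1)])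
  define k where "k v = (if v = d' then s * u d' else (1 - s) / 3 + s * u v)" for v
  have k: "k p = (1 - s) / 3 + s * u p" "k q = (1 - s) / 3 + s * u q" "k r = (1 - s) / 3 + s * u r" "k d' = s * u d'"
    using tetrahedron.distinct[OF t'(1)] by (auto simp: k_def)
  have "sum k {p, q, r, d'} = (1 - s) + s * sum u {p, q, r, d'}"
    unfolding S k by (simp add: field_simps)
  then have k1: "sum k {p, q, r, d'} = 1" unfolding u(1) by simp
  have xk: "?x = (\<Sum>v\<in>{p, q, r, d'}. k v *\<^sub>R v)"
    unfolding bf u(2)[symmetric] S k by (simp add: vec_eq_iff field_simps)
  have k0: "0 < k v" if "v \<in> {p, q, r, d'}" for v
    using that small[of p] small[of q] small[of r] s \<open>0 < u d'\<close> by (auto simp: k M_def)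
  have "?x \<in> rel_interior c'"
    unfolding t'(2) rel_interior_convex_hull_explicit[OF tetrahedron.independent[OF t'(1)]]
    by (intro CollectI exI[of _ k] conjI ballI k0 k1 xk[symmetric])
  moreover have "?x \<in> c"
  proof -
    have "?b \<in> c"
      using barycenter_in_rel_interior[OF f] rel_interior_subset facet_of_imp_subset[OF cT(2)] by blast
    moreover have "d \<in> c" by (simp add: t(2) hull_inc)
    ultimately show ?thesis using s by (intro convexD) (auto simp: t(2))
  qed
  ultimately have "(c' \<inter> c) \<inter> rel_interior c' \<noteq> {}" using rel_interior_subset by blast
  \<comment> \<open>A face that meets the relative interior is the whole cell; \<open>c'\<close> is
    then a face of \<open>c\<close> of the same dimension 3, hence equal to it.\<close>
  then have "c' \<inter> c = c'" using face_of_disjoint_rel_interior Int_face_of[OF cT(3,1)] by blast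
  then have "c' face_of c" using Int_face_of[OF cT(1,3)] by (simp add: Int_commute)
  moreover have "convex c" by (simp add: t(2))
  ultimately show ?thesis
    using face_of_aff_dim_lt[of c c'] aff_dim_cell cT by force
qed

text \<open>Existence and uniqueness, applied to \<open>w\<close> and to \<open>- w\<close>, leave
  one term 1 and one term -1. The normal may have any length, which suits both
  \<open>\<nu> f\<close> and the normals built from edge vectors.\<close>

lemma sum_sgn_sides:
  assumes f: "f \<in> grid_faces \<T>" and b: "barycenter f \<in> interior (\<Union>\<T>)"
    and w: "\<And>x y. x \<in> f \<Longrightarrow> y \<in> f \<Longrightarrow> w \<bullet> (x - y) = 0"
  shows "(\<Sum>c\<in>cells_containing \<T> f. sgn (w \<bullet> (barycenter c - barycenter f))) = 0"
proof (cases "w = 0")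
  case False
  let ?h = "\<lambda>c. w \<bullet> (barycenter c - barycenter f)"
  have w': "(- w) \<bullet> (x - y) = 0" if "x \<in> f" "y \<in> f" for x y using w[OF that] by simp
  obtain c1 where c1: "c1 \<in> cells_containing \<T> f" "0 < ?h c1"
    using cell_on_positive_side[OF f b False w] by blast
  obtain c2 where c2: "c2 \<in> cells_containing \<T> f" "?h c2 < 0"
    using cell_on_positive_side[OF f b _ w'] False by auto
  have "c = c1 \<or> c = c2 \<or> ?h c = 0" if "c \<in> cells_containing \<T> f" for c
    using cell_on_positive_side_unique[OF f w that _ c1]
      cell_on_positive_side_unique[OF f w' that _ c2(1)] c2(2)
    by (cases "?h c" "0::real" rule: linorder_cases) auto
  then have "\<forall>c\<in>cells_containing \<T> f - {c1, c2}. sgn (?h c) = 0" by fastforce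
  moreover have "finite (cells_containing \<T> f)" using finite_cells by (simp add: cells_containing_def)
  ultimately have "(\<Sum>c\<in>cells_containing \<T> f. sgn (?h c)) = (\<Sum>c\<in>{c1, c2}. sgn (?h c))"
    using c1(1) c2(1) by (intro sum.mono_neutral_right) simp_all
  also have "\<dots> = 0" using c1 c2 by (subst sum.insert) auto
  finally show ?thesis .
qed simp

end

subsection \<open>Summation over the cells at a node\<close>

context tetrahedron
begin

text \<open>The vector is a multiple of \<open>cross3 (a - n) (b - n)\<close>: the barycenters
  differ from \<open>(1/3) *\<^sub>R (b - n)\<close> by a multiple of the edge. It is the normal to
  which \<open>sum_sgn_sides\<close> is applied.\<close>

lemma edge_face_normal:
  assumes "x \<in> convex hull {n, a, b}" "y \<in> convex hull {n, a, b}"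
  shows "cross3 (s *\<^sub>R (a - n)) (barycenter (convex hull {n, a, b}) - barycenter (convex hull {n, a})) \<bullet> (x - y) = 0"
proof -
  let ?w = "cross3 (s *\<^sub>R (a - n)) (barycenter (convex hull {n, a, b}) - barycenter (convex hull {n, a}))"
  have b: "barycenter (convex hull {n, a, b}) - barycenter (convex hull {n, a}) = (1/3) *\<^sub>R (b - n) - (1/6) *\<^sub>R (a - n)"
    unfolding barycenters by (simp add: vec_eq_iff algebra_simps)
  have "cross3 (s *\<^sub>R p) ((1/3) *\<^sub>R q - (1/6) *\<^sub>R p) = (s/3) *\<^sub>R cross3 p q" for p q :: point
    by (simp add: vec_eq_iff forall_3 cross3_def field_simps)
  then have w: "?w = (s/3) *\<^sub>R cross3 (a - n) (b - n)" unfolding b .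
  have "?w \<bullet> (a - n) = 0" "?w \<bullet> (b - n) = 0" unfolding w by (simp_all add: dot_cross_self)
  then have "{n, a, b} \<subseteq> {x. ?w \<bullet> x = ?w \<bullet> n}" by (auto simp: inner_diff_right)
  then have "convex hull {n, a, b} \<subseteq> {x. ?w \<bullet> x = ?w \<bullet> n}"
    by (intro hull_minimal convex_hyperplane)
  then have "?w \<bullet> x = ?w \<bullet> n" "?w \<bullet> y = ?w \<bullet> n" using assms by blast+
  then show ?thesis by (simp add: inner_diff_right)
qed

lemma edge_cases:
  assumes "e edge_of convex hull {n, a, b, d}" "n \<in> e"
  obtains p q r where "tetrahedron n p q r" "{n, p, q, r} = {n, a, b, d}" "e = convex hull {n, p}"
proof -
  have "e \<in> {convex hull {n, a}, convex hull {n, b}, convex hull {n, d}}"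
    using assms unfolding edges_at[symmetric] by simp
  then show thesis
    using that[OF tetrahedron_axioms] that[OF swap(3)] that[OF swap(4)] by (auto simp: insert_commute)
qed

lemma face_cases:
  assumes "f facet_of convex hull {n, a, b, d}" "n \<in> f"
  obtains p q r where "tetrahedron n p q r" "{n, p, q, r} = {n, a, b, d}" "f = convex hull {n, p, q}"
proof -
  have "f \<in> {convex hull {n, a, b}, convex hull {n, a, d}, convex hull {n, b, d}}"
    using assms unfolding facets_at[symmetric] by simp
  then show thesis
    using that[OF tetrahedron_axioms] that[OF swap(2)] that[OF swap(3)] by (auto simp: insert_commute)
qed

lemma barycenter_face_in_dual_cell_part:
  "barycenter (convex hull {n, a, b}) \<in> dual_cell_part n (convex hull {n, a, b, d})"
  using flag_hull_subset_dual_cell_part unfolding barycenters(2) by (auto simp: hull_inc)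

end

text \<open>A segment determines its end points up to order and the sign condition fixes the order;
  \<open>\<sigma>\<close> records whether \<open>x\<close> is the tail of the oriented edge.\<close>

lemma the_positive_segment:
  fixes x E :: "'a::euclidean_space" and \<sigma> :: real
  assumes "E \<noteq> 0" "\<sigma> = 1 \<or> \<sigma> = - 1"
  shows "(THE v. \<exists>x' y'. closed_segment x (x + (\<sigma> / 2) *\<^sub>R E) = closed_segment x' y' \<and> v = y' - x' \<and> v \<bullet> E > 0)
    = (1/2) *\<^sub>R E"
proof -
  have E: "E \<bullet> E > 0" using assms(1) by simp
  have *: "(\<exists>x' y'. {x, z} = {x', y'} \<and> Q x' y') \<longleftrightarrow> Q x z \<or> Q z x" for z :: 'a and Q
    by (auto simp: doubleton_eq_iff)
  have "(\<exists>x' y'. {x, x + (\<sigma> / 2) *\<^sub>R E} = {x', y'} \<and> v = y' - x' \<and> v \<bullet> E > 0) \<longleftrightarrow>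
      (v = (\<sigma> / 2) *\<^sub>R E \<or> v = (- \<sigma> / 2) *\<^sub>R E) \<and> v \<bullet> E > 0" for v
    unfolding * by auto
  moreover have "(v = (\<sigma> / 2) *\<^sub>R E \<or> v = (- \<sigma> / 2) *\<^sub>R E) \<and> v \<bullet> E > 0 \<longleftrightarrow> v = (1/2) *\<^sub>R E" for v
    using assms(2) inner_ge_zero[of E] E by (auto simp del: inner_gt_zero_iff)
  ultimately show ?thesis by simp
qed

section \<open>The dual cell of a mesh node: traces, volume and incidence\<close>

locale mesh_node = tetrahedral_mesh +
  fixes n :: point
  assumes node: "n \<in> grid_nodes \<T>"
begin

text \<open>Conformity excludes hanging nodes: the face \<open>{n}\<close> of one cell is a face of
  every cell that contains it.\<close>

lemma node_vertex:
  assumes "c \<in> \<T>" "n \<in> c"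
  shows "n \<in> vertices c"
proof -
  obtain c0 where "c0 \<in> \<T>" "n extreme_point_of c0"
    using node by (auto simp: grid_nodes_def vertices_def)
  then have "{n} face_of c" using face_of_other_cell[of "{n}" c0 c] assms by (simp add: face_of_singleton)
  then show ?thesis by (simp add: face_of_singleton vertices_def)
qed

lemma finite_cells_at: "finite (cells_at \<T> n)"
  using finite_cells by (simp add: cells_at_def)

lemma cell_at:
  assumes "c \<in> cells_at \<T> n"
  obtains a b d where "tetrahedron n a b d" "c = convex hull {n, a, b, d}"
  using assms node_vertex cell_tetrahedron by (metis (no_types, lifting) cells_at_def mem_Collect_eq)

text \<open>The dual cell also has parts in other cells. A point of such a part lying in
  \<open>convex hull F\<close> belongs to the common face of the two cells, which contains
  \<open>n\<close>; domination by \<open>n\<close> passes from the other cell to this face and from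
  there to the given cell.\<close>

lemma hull_Int_dual_cell:
  assumes t: "tetrahedron n a b d" and c: "convex hull {n, a, b, d} \<in> \<T>"
    and F: "F \<subseteq> {n, a, b, d}" "n \<in> F"
  shows "convex hull F \<inter> dual_cell \<T> n = dominant_region n F"
proof
  let ?S = "{n, a, b, d}" and ?c = "convex hull {n, a, b, d}"
  have ind: "\<not> affine_dependent ?S" by (rule tetrahedron.independent[OF t])
  have face: "dominant_region n F = dominant_region n ?S \<inter> convex hull F"
    using ind F by (intro dominant_region_face) auto
  have "?c \<in> cells_at \<T> n" using c by (simp add: cells_at_def hull_inc)
  then have "dominant_region n ?S \<subseteq> dual_cell \<T> n"
    unfolding dual_cell_def tetrahedron.dual_cell_part_eq[OF t, symmetric] by blast
  then show "dominant_region n F \<subseteq> convex hull F \<inter> dual_cell \<T> n" using face by blast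
  show "convex hull F \<inter> dual_cell \<T> n \<subseteq> dominant_region n F"
  proof
    fix x assume x: "x \<in> convex hull F \<inter> dual_cell \<T> n"
    then obtain c' where c': "c' \<in> cells_at \<T> n" "x \<in> dual_cell_part n c'"
      by (auto simp: dual_cell_def)
    obtain a' b' d' where t': "tetrahedron n a' b' d'" "c' = convex hull {n, a', b', d'}"
      using cell_at[OF c'(1)] .
    let ?S' = "{n, a', b', d'}"
    have ind': "\<not> affine_dependent ?S'" by (rule tetrahedron.independent[OF t'(1)])
    have x': "x \<in> dominant_region n ?S'"
      using c'(2) unfolding t'(2) tetrahedron.dual_cell_part_eq[OF t'(1)] .
    have "(?c \<inter> c') face_of ?c" "(?c \<inter> c') face_of c'"
      using Int_face_of[OF c, of c'] Int_face_of[OF _ c, of c'] c'(1) by (auto simp: cells_at_def Int_commute)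
    then obtain I I' where I: "I \<subseteq> ?S" "?c \<inter> c' = convex hull I" "I' \<subseteq> ?S'" "?c \<inter> c' = convex hull I'"
      unfolding t'(2) face_of_convex_hull_affine_independent[OF ind] face_of_convex_hull_affine_independent[OF ind']
      by blast
    have "\<not> affine_dependent I" "\<not> affine_dependent I'"
      using I ind ind' affine_independent_subset by blast+
    then have "I = I'" using I(2,4) convex_hull_affine_independent_inj by metis
    have "n \<in> ?c \<inter> c'" unfolding t'(2) by (simp add: hull_inc)
    then have "n \<in> I"
      using mem_convex_hull_affine_independent[OF ind I(1), of n] unfolding I(2) by simp
    have "x \<in> ?c" using x F hull_mono[of F ?S convex] by blast
    moreover have "x \<in> c'" using x' dominant_region_subset_hull[of ?S' n] unfolding t'(2) by blast
    ultimately have "x \<in> convex hull I" using I(2) by blast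
    then have "x \<in> dominant_region n I"
      using dominant_region_face[OF _ ind', of I n] x' \<open>n \<in> I\<close> I(3) \<open>I = I'\<close> by simp
    then have "x \<in> dominant_region n ?S"
      using dominant_region_face[OF _ ind I(1) \<open>n \<in> I\<close>] by simp
    then show "x \<in> dominant_region n F" using x face by blast
  qed
qed

lemma dual_cell_part_subset:
  assumes c: "c \<in> cells_at \<T> n"
  shows "dual_cell_part n c \<subseteq> c"
proof -
  obtain a b d where t: "tetrahedron n a b d" "c = convex hull {n, a, b, d}" using cell_at[OF c] .
  show ?thesis unfolding t(2) tetrahedron.dual_cell_part_eq[OF t(1)]
    by (intro dominant_region_subset_hull) simp
qed

lemma measure_dual_cell:
  "measure lebesgue (dual_cell \<T> n) = (\<Sum>c\<in>cells_at \<T> n. measure lebesgue (dual_cell_part n c))"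
  unfolding dual_cell_def
proof (rule measure_negligible_finite_Union_image)
  show "finite (cells_at \<T> n)" by (rule finite_cells_at)
  show "dual_cell_part n c \<in> lmeasurable" if c: "c \<in> cells_at \<T> n" for c
  proof -
    obtain a b d where t: "tetrahedron n a b d" "c = convex hull {n, a, b, d}" using cell_at[OF c] .
    show ?thesis unfolding t(2) tetrahedron.dual_cell_part_eq[OF t(1)]
      by (intro lmeasurable_compact tetrahedron.compact_dominant_region t)
  qed
  show "pairwise (\<lambda>c c'. negligible (dual_cell_part n c \<inter> dual_cell_part n c')) (cells_at \<T> n)"
    unfolding pairwise_def
  proof (intro ballI impI)
    fix c c' assume cc: "c \<in> cells_at \<T> n" "c' \<in> cells_at \<T> n" "c \<noteq> c'"
    then have T: "c \<in> \<T>" "c' \<in> \<T>" by (auto simp: cells_at_def)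
    then have con: "convex c" "convex c'" using cell_hull by (metis convex_convex_hull)+
    \<comment> \<open>Distinct cells of equal dimension meet in a proper face, which lies in the
      frontier of a convex set and is therefore null.\<close>
    have "c \<inter> c' \<noteq> c"
    proof
      assume "c \<inter> c' = c"
      then have "c face_of c'" using Int_face_of[OF T(2,1)] by (simp add: Int_commute)
      then show False using face_of_aff_dim_lt[OF con(2)] aff_dim_cell T \<open>c \<noteq> c'\<close> by fastforce
    qed
    then have "(c \<inter> c') \<inter> interior c = {}" using face_of_disjoint_interior Int_face_of[OF T] by blast
    then have "c \<inter> c' \<subseteq> frontier c" using closure_subset by (auto simp: frontier_def)
    then show "negligible (dual_cell_part n c \<inter> dual_cell_part n c')"
      using dual_cell_part_subset[OF cc(1)] dual_cell_part_subset[OF cc(2)] negligible_convex_frontier[OF con(1)]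
      by (meson Int_mono negligible_subset)
  qed
qed

lemma edges_at_subset:
  "c \<in> \<T> \<Longrightarrow> {e \<in> edges_at \<T> n. e \<subseteq> c} = {e. e edge_of c \<and> n \<in> e}"
  using edge_of_cell_iff by (auto simp: edges_at_def grid_edges_def dest: edge_of_imp_subset)

lemma faces_at_subset:
  "c \<in> \<T> \<Longrightarrow> {f \<in> faces_at \<T> n. f \<subseteq> c} = {f. f facet_of c \<and> n \<in> f}"
  using facet_of_cell_iff by (auto simp: faces_at_def grid_faces_def dest: facet_of_imp_subset)

lemma finite_edges_at: "finite (edges_at \<T> n)"
proof -
  have "edges_at \<T> n \<subseteq> (\<Union>c\<in>cells_at \<T> n. {e. e edge_of c \<and> n \<in> e})"
    by (auto simp: edges_at_def grid_edges_def cells_at_def dest: edge_of_imp_subset)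
  moreover have "finite {e. e edge_of c \<and> n \<in> e}" if c: "c \<in> cells_at \<T> n" for c
  proof -
    obtain a b d where t: "tetrahedron n a b d" "c = convex hull {n, a, b, d}" using cell_at[OF c] .
    show ?thesis unfolding t(2) tetrahedron.edges_at[OF t(1)] by simp
  qed
  ultimately show ?thesis by (meson finite_UN_I finite_subset finite_cells_at)
qed

lemma finite_faces_at: "finite (faces_at \<T> n)"
proof -
  have "faces_at \<T> n \<subseteq> (\<Union>c\<in>cells_at \<T> n. {f. f facet_of c \<and> n \<in> f})"
    by (auto simp: faces_at_def grid_faces_def cells_at_def dest: facet_of_imp_subset)
  moreover have "finite {f. f facet_of c \<and> n \<in> f}" if c: "c \<in> cells_at \<T> n" for c
  proof -
    obtain a b d where t: "tetrahedron n a b d" "c = convex hull {n, a, b, d}" using cell_at[OF c] .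
    show ?thesis unfolding t(2) tetrahedron.facets_at[OF t(1)] by simp
  qed
  ultimately show ?thesis by (meson finite_UN_I finite_subset finite_cells_at)
qed

text \<open>Double counting of incident pairs; a cell containing \<open>s\<close> is a cell at
  \<open>n\<close> because \<open>n\<close> lies in \<open>s\<close>.\<close>

lemma sum_over_cells:
  fixes g :: "point set \<Rightarrow> point set \<Rightarrow> 'b::comm_monoid_add"
  assumes "finite A" "\<And>s. s \<in> A \<Longrightarrow> n \<in> s"
  shows "(\<Sum>s\<in>A. \<Sum>c\<in>cells_containing \<T> s. g s c) = (\<Sum>c\<in>cells_at \<T> n. \<Sum>s | s \<in> A \<and> s \<subseteq> c. g s c)"
proof -
  have "(\<Sum>s\<in>A. \<Sum>c\<in>cells_containing \<T> s. g s c) = (\<Sum>s\<in>A. \<Sum>c | c \<in> cells_at \<T> n \<and> s \<subseteq> c. g s c)"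
    using assms(2) by (intro sum.cong) (auto simp: cells_containing_def cells_at_def)
  also have "\<dots> = (\<Sum>c\<in>cells_at \<T> n. \<Sum>s | s \<in> A \<and> s \<subseteq> c. g s c)"
    using assms(1) finite_cells_at by (rule sum.swap_restrict)
  finally show ?thesis .
qed

lemma edge_vec_in_dual_eq:
  assumes oe: "edge_orientation \<T> oe" and e: "e \<in> edges_at \<T> n"
  shows "edge_vec_in_dual \<T> oe n e = (1/2) *\<^sub>R edge_vec oe e"
proof -
  obtain c where c: "c \<in> cells_at \<T> n" "e edge_of c" "n \<in> e" "e \<in> grid_edges \<T>"
    using e by (auto simp: edges_at_def grid_edges_def cells_at_def dest: edge_of_imp_subset)
  obtain a' b' d' where t': "tetrahedron n a' b' d'" "c = convex hull {n, a', b', d'}" using cell_at[OF c(1)] .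
  have "\<exists>a b d. tetrahedron n a b d \<and> c = convex hull {n, a, b, d} \<and> e = convex hull {n, a}"
    using tetrahedron.edge_cases[OF t'(1) c(2)[unfolded t'(2)] c(3)] unfolding t'(2) by metis
  then obtain a b d where t: "tetrahedron n a b d" "c = convex hull {n, a, b, d}" "e = convex hull {n, a}"
    by blast
  have "n \<noteq> a" by (rule tetrahedron.distinct[OF t(1)])
  have "vertices e = {n, a}"
    unfolding t(3) by (intro vertices_convex_hull tetrahedron.subset_independent[OF t(1)]) auto
  then have "{fst (oe e), snd (oe e)} = {n, a}" using oe c(4) by (simp add: edge_orientation_def)
  then have ev: "edge_vec oe e = a - n \<or> edge_vec oe e = n - a"
    by (auto simp: edge_vec_def doubleton_eq_iff)
  have seg: "e \<inter> dual_cell \<T> n = closed_segment n ((1/2) *\<^sub>R (n + a))"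
    unfolding t(3) using hull_Int_dual_cell[OF t(1), of "{n, a}"] c(1)
    by (simp add: t(2) cells_at_def dominant_region_segment[OF \<open>n \<noteq> a\<close>])
  obtain \<sigma> :: real where \<sigma>: "\<sigma> = 1 \<or> \<sigma> = - 1" and E: "edge_vec oe e = \<sigma> *\<^sub>R (a - n)"
    using ev by (metis minus_diff_eq scaleR_minus1_left scaleR_one)
  have "edge_vec oe e \<noteq> 0" using \<sigma> \<open>n \<noteq> a\<close> unfolding E by auto
  moreover have "(1/2) *\<^sub>R (n + a) = n + (\<sigma> / 2) *\<^sub>R edge_vec oe e"
    using \<sigma> unfolding E by (auto simp: vec_eq_iff field_simps)
  ultimately show ?thesis
    using the_positive_segment[OF _ \<sigma>, of "edge_vec oe e" n]
    unfolding edge_vec_in_dual_def seg by simp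
qed


lemma edge_vec_cases:
  assumes "edge_orientation \<T> oe" "tetrahedron n a b d" "convex hull {n, a, b, d} \<in> \<T>"
  shows "edge_vec oe (convex hull {n, a}) = a - n \<or> edge_vec oe (convex hull {n, a}) = n - a"
proof -
  have "convex hull {n, a} \<in> grid_edges \<T>"
    using tetrahedron.edges_at[OF assms(2)] assms(3) by (auto simp: grid_edges_def)
  moreover have "vertices (convex hull {n, a}) = {n, a}"
    by (intro vertices_convex_hull tetrahedron.subset_independent[OF assms(2)]) auto
  ultimately have "{fst (oe (convex hull {n, a})), snd (oe (convex hull {n, a}))} = {n, a}"
    using assms(1) by (simp add: edge_orientation_def)
  then show ?thesis by (auto simp: edge_vec_def doubleton_eq_iff)
qed

section \<open>The identities with boundary terms\<close>

lemma sum_edges_with_bdry: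
  assumes oe: "edge_orientation \<T> oe"
  shows "(\<Sum>e\<in>edges_at \<T> n. outer (edge_vec_in_dual \<T> oe n e) (dual_face_vec \<T> oe e + bdry_face_vec \<T> oe n e))
    = measure lebesgue (dual_cell \<T> n) *\<^sub>R mat 1"
proof -
  let ?t = "\<lambda>e c. outer (edge_vec_in_dual \<T> oe n e) (dual_face_vec_part oe e c + bdry_face_vec_part oe n e c)"
  have "(\<Sum>e\<in>edges_at \<T> n. outer (edge_vec_in_dual \<T> oe n e) (dual_face_vec \<T> oe e + bdry_face_vec \<T> oe n e)) =
      (\<Sum>e\<in>edges_at \<T> n. \<Sum>c\<in>cells_containing \<T> e. ?t e c)"
    by (simp add: dual_face_vec_def bdry_face_vec_def outer_sum_right sum.distrib[symmetric])
  also have "\<dots> = (\<Sum>c\<in>cells_at \<T> n. \<Sum>e | e \<in> edges_at \<T> n \<and> e \<subseteq> c. ?t e c)"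
    by (rule sum_over_cells[OF finite_edges_at]) (simp add: edges_at_def)
  also have "\<dots> = (\<Sum>c\<in>cells_at \<T> n. measure lebesgue (dual_cell_part n c) *\<^sub>R mat 1)"
  proof (rule sum.cong[OF refl])
    fix c assume c: "c \<in> cells_at \<T> n"
    obtain a b d where t: "tetrahedron n a b d" "c = convex hull {n, a, b, d}" using cell_at[OF c] .
    have cT: "convex hull {n, a, b, d} \<in> \<T>" using c t(2) by (simp add: cells_at_def)
    \<comment> \<open>The cyclic relabellings bring each of the three edges at \<open>n\<close> into
      the first position.\<close>
    have perm: "tetrahedron n p q r \<and> convex hull {n, p, q, r} \<in> \<T>"
      if "(p, q, r) \<in> {(a, b, d), (b, d, a), (d, a, b)}" for p q r
      using that t(1) cT tetrahedron.swap(3,4)[OF t(1)] by (auto simp: insert_commute)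
    have vec: "edge_vec oe (convex hull {n, p}) = p - n \<or> edge_vec oe (convex hull {n, p}) = n - p"
      if "p \<in> {a, b, d}" for p
      using that edge_vec_cases[OF oe, of a b d] edge_vec_cases[OF oe, of b d a] edge_vec_cases[OF oe, of d a b]
        perm by blast
    have "convex hull {n, p} \<in> edges_at \<T> n" if "p \<in> {a, b, d}" for p
      using tetrahedron.edges_at[OF t(1)] cT that edges_at_subset[OF cT] by blast
    then have half: "edge_vec_in_dual \<T> oe n (convex hull {n, p}) = (1/2) *\<^sub>R edge_vec oe (convex hull {n, p})"
      if "p \<in> {a, b, d}" for p
      using edge_vec_in_dual_eq[OF oe] that by blast
    show "(\<Sum>e | e \<in> edges_at \<T> n \<and> e \<subseteq> c. ?t e c) = measure lebesgue (dual_cell_part n c) *\<^sub>R mat 1"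
      unfolding t(2) edges_at_subset[OF cT] by (rule tetrahedron.sum_outer_edge_terms[OF t(1) vec half])
  qed
  finally show ?thesis by (simp add: measure_dual_cell scaleR_left.sum)
qed

lemma sum_faces_with_bdry:
  assumes \<nu>: "face_orientation \<T> \<nu>"
  shows "(\<Sum>f\<in>faces_at \<T> n. outer (face_vec_in_dual \<T> \<nu> n f) (dual_edge_vec \<T> \<nu> f + bdry_edge_vec \<T> \<nu> n f))
    = measure lebesgue (dual_cell \<T> n) *\<^sub>R mat 1"
proof -
  let ?t = "\<lambda>f c. outer (face_vec_in_dual \<T> \<nu> n f) (dual_edge_vec_part \<nu> f c + bdry_edge_vec_part \<nu> n f c)"
  have "(\<Sum>f\<in>faces_at \<T> n. outer (face_vec_in_dual \<T> \<nu> n f) (dual_edge_vec \<T> \<nu> f + bdry_edge_vec \<T> \<nu> n f)) =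
      (\<Sum>f\<in>faces_at \<T> n. \<Sum>c\<in>cells_containing \<T> f. ?t f c)"
    by (simp add: dual_edge_vec_def bdry_edge_vec_def outer_sum_right sum.distrib[symmetric])
  also have "\<dots> = (\<Sum>c\<in>cells_at \<T> n. \<Sum>f | f \<in> faces_at \<T> n \<and> f \<subseteq> c. ?t f c)"
    by (rule sum_over_cells[OF finite_faces_at]) (simp add: faces_at_def)
  also have "\<dots> = (\<Sum>c\<in>cells_at \<T> n. measure lebesgue (dual_cell_part n c) *\<^sub>R mat 1)"
  proof (rule sum.cong[OF refl])
    fix c assume c: "c \<in> cells_at \<T> n"
    obtain a b d where t: "tetrahedron n a b d" "c = convex hull {n, a, b, d}" using cell_at[OF c] .
    have cT: "convex hull {n, a, b, d} \<in> \<T>" using c t(2) by (simp add: cells_at_def)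
    have g: "f \<in> grid_faces \<T>" if "f facet_of convex hull {n, a, b, d}" for f
      using that cT by (auto simp: grid_faces_def)
    show "(\<Sum>f | f \<in> faces_at \<T> n \<and> f \<subseteq> c. ?t f c) = measure lebesgue (dual_cell_part n c) *\<^sub>R mat 1"
      unfolding t(2) faces_at_subset[OF cT]
    proof (rule tetrahedron.sum_outer_face_terms[OF t(1)])
      fix p q assume "p \<in> {a, b, d}" "q \<in> {a, b, d}"
      then have "{n, p, q} \<subseteq> {n, a, b, d}" by blast
      then show "face_vec_in_dual \<T> \<nu> n (convex hull {n, p, q}) =
          planar_area (\<nu> (convex hull {n, p, q})) (dominant_region n {n, p, q}) *\<^sub>R \<nu> (convex hull {n, p, q})"
        unfolding face_vec_in_dual_def by (subst hull_Int_dual_cell[OF t(1) cT]) auto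
    qed (use \<nu> g in \<open>auto simp: face_orientation_def\<close>)
  qed
  finally show ?thesis by (simp add: measure_dual_cell scaleR_left.sum)
qed

section \<open>Vanishing of the boundary terms away from the boundary\<close>

lemma barycenter_face_in_dual_cell:
  assumes "f \<in> faces_at \<T> n"
  shows "barycenter f \<in> dual_cell \<T> n"
proof -
  obtain c where c: "c \<in> cells_at \<T> n" "f facet_of c" "n \<in> f"
    using assms by (auto simp: faces_at_def grid_faces_def cells_at_def dest: facet_of_imp_subset)
  obtain a b d where t: "tetrahedron n a b d" "c = convex hull {n, a, b, d}" using cell_at[OF c(1)] .
  obtain p q r where "tetrahedron n p q r" "{n, p, q, r} = {n, a, b, d}" "f = convex hull {n, p, q}"
    using tetrahedron.face_cases[OF t(1) c(2)[unfolded t(2)] c(3)] .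
  then have "barycenter f \<in> dual_cell_part n c"
    unfolding t(2) using tetrahedron.barycenter_face_in_dual_cell_part by metis
  then show ?thesis using c(1) by (auto simp: dual_cell_def)
qed

text \<open>Every cell at \<open>f\<close> contributes the same vector up to the sign of its side,
  so the sum of the signs factors out.\<close>

lemma bdry_edge_vec_eq_0:
  assumes \<nu>: "face_orientation \<T> \<nu>" and int: "dual_cell \<T> n \<subseteq> interior (\<Union>\<T>)" and f: "f \<in> faces_at \<T> n"
  shows "bdry_edge_vec \<T> \<nu> n f = 0"
proof -
  have fg: "f \<in> grid_faces \<T>" "n \<in> f" using f by (auto simp: faces_at_def)
  have b: "barycenter f \<in> interior (\<Union>\<T>)" using barycenter_face_in_dual_cell[OF f] int by blast
  have nu: "norm (\<nu> f) = 1" "\<And>x y. x \<in> f \<Longrightarrow> y \<in> f \<Longrightarrow> \<nu> f \<bullet> (x - y) = 0"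
    using \<nu> fg(1) by (auto simp: face_orientation_def)
  have "bdry_edge_vec_part \<nu> n f c =
      - sgn (\<nu> f \<bullet> (barycenter c - barycenter f)) *\<^sub>R (face_point n f - barycenter f)"
    if c: "c \<in> cells_containing \<T> f" for c
  proof -
    have cn: "c \<in> cells_at \<T> n" "f facet_of c"
      using c fg by (auto simp: cells_containing_facets cells_at_def dest: facet_of_imp_subset)
    obtain a b d where t: "tetrahedron n a b d" "c = convex hull {n, a, b, d}" using cell_at[OF cn(1)] .
    obtain p q r where pqr: "tetrahedron n p q r" "{n, p, q, r} = {n, a, b, d}" "f = convex hull {n, p, q}"
      using tetrahedron.face_cases[OF t(1) cn(2)[unfolded t(2)] fg(2)] .
    have "bdry_edge_vec_part \<nu> n f c = sgn ((barycenter f - barycenter c) \<bullet> \<nu> f) *\<^sub>R (face_point n f - barycenter f)"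
      unfolding t(2) pqr(2)[symmetric] unfolding pqr(3)
      by (rule tetrahedron.bdry_edge_vec_part_eq[OF pqr(1)]) (use nu pqr(3) in auto)
    moreover have "(barycenter f - barycenter c) \<bullet> \<nu> f = - (\<nu> f \<bullet> (barycenter c - barycenter f))"
      by (simp add: inner_diff_right inner_diff_left inner_commute)
    ultimately show ?thesis by (simp add: sgn_minus)
  qed
  then have "bdry_edge_vec \<T> \<nu> n f =
      - ((\<Sum>c\<in>cells_containing \<T> f. sgn (\<nu> f \<bullet> (barycenter c - barycenter f))) *\<^sub>R (face_point n f - barycenter f))"
    by (simp add: bdry_edge_vec_def scaleR_left.sum sum_negf)
  then show ?thesis using sum_sgn_sides[OF fg(1) b nu(2)] by simp
qed

text \<open>The cells around an edge do not cancel in pairs as they stand: each one shares its two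
  faces with different neighbours. Writing each cell's term as a sum over its faces through
  \<open>e\<close> and summing over faces first brings the cancelling contributions
  together.\<close>

lemma bdry_face_vec_eq_0:
  assumes oe: "edge_orientation \<T> oe" and int: "dual_cell \<T> n \<subseteq> interior (\<Union>\<T>)" and e: "e \<in> edges_at \<T> n"
  shows "bdry_face_vec \<T> oe n e = 0"
proof -
  let ?w = "\<lambda>f. cross3 (edge_vec oe e) (barycenter f - barycenter e)"
  let ?g = "\<lambda>f c. sgn (?w f \<bullet> (barycenter c - barycenter f)) *\<^sub>R (- (1/2)) *\<^sub>R
    cross3 (barycenter f - barycenter e) (edge_point n e - barycenter e)"
  let ?F = "{f \<in> faces_at \<T> n. e \<subseteq> f}"
  have eg: "e \<in> grid_edges \<T>" "n \<in> e" using e by (auto simp: edges_at_def)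
  have edge: "\<exists>p q r s. tetrahedron n p q r \<and> c = convex hull {n, p, q, r} \<and> e = convex hull {n, p} \<and>
      (s = 1 \<or> s = - 1) \<and> edge_vec oe e = s *\<^sub>R (p - n)"
    if c: "c \<in> cells_at \<T> n" "e \<subseteq> c" for c
  proof -
    have cT: "c \<in> \<T>" using c(1) by (simp add: cells_at_def)
    have ec: "e edge_of c" using edge_of_cell_iff[OF eg(1) cT] c(2) by simp
    obtain a b d where t: "tetrahedron n a b d" "c = convex hull {n, a, b, d}" using cell_at[OF c(1)] .
    obtain p q r where pqr: "tetrahedron n p q r" "{n, p, q, r} = {n, a, b, d}" "e = convex hull {n, p}"
      using tetrahedron.edge_cases[OF t(1) ec[unfolded t(2)] eg(2)] .
    then have "edge_vec oe e = p - n \<or> edge_vec oe e = n - p"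
      using edge_vec_cases[OF oe pqr(1)] cT unfolding t(2) by simp
    then have "\<exists>s. (s = 1 \<or> s = - 1) \<and> edge_vec oe e = s *\<^sub>R (p - n)"
      by (auto intro: exI[of _ "1::real"] exI[of _ "- 1::real"])
    then show ?thesis using pqr t(2) by metis
  qed
  have "bdry_face_vec_part oe n e c = (\<Sum>f | f \<in> ?F \<and> f \<subseteq> c. ?g f c)" if "c \<in> cells_containing \<T> e" for c
  proof -
    have cn: "c \<in> cells_at \<T> n" "e \<subseteq> c" "c \<in> \<T>"
      using that eg by (auto simp: cells_containing_def cells_at_def)
    obtain p q r s where t: "tetrahedron n p q r" "c = convex hull {n, p, q, r}" "e = convex hull {n, p}"
      "s = 1 \<or> s = - 1" "edge_vec oe e = s *\<^sub>R (p - n)" using edge[OF cn(1,2)] by blast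
    have "{f. f \<in> ?F \<and> f \<subseteq> c} = {f. f facet_of c \<and> e \<subseteq> f}"
      using faces_at_subset[OF cn(3)] eg(2) by blast
    then show ?thesis
      using tetrahedron.bdry_face_vec_part_eq[OF t(1,4) t(5)[unfolded t(3)]] unfolding t(2,3) by simp
  qed
  then have "bdry_face_vec \<T> oe n e = (\<Sum>c\<in>cells_containing \<T> e. \<Sum>f | f \<in> ?F \<and> f \<subseteq> c. ?g f c)"
    by (simp add: bdry_face_vec_def)
  also have "\<dots> = (\<Sum>f\<in>?F. \<Sum>c | c \<in> cells_containing \<T> e \<and> f \<subseteq> c. ?g f c)"
    using finite_cells finite_faces_at by (intro sum.swap_restrict) (auto simp: cells_containing_def)
  \<comment> \<open>As \<open>e \<subseteq> f\<close>, every cell containing \<open>f\<close> is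
    among the cells around \<open>e\<close>.\<close>
  also have "\<dots> = (\<Sum>f\<in>?F. \<Sum>c\<in>cells_containing \<T> f. ?g f c)"
    by (intro sum.cong) (auto simp: cells_containing_def)
  also have "\<dots> = (\<Sum>f\<in>?F. 0)"
  proof (rule sum.cong[OF refl])
    fix f assume f: "f \<in> ?F"
    have fg: "f \<in> grid_faces \<T>" "n \<in> f" using f by (auto simp: faces_at_def)
    have b: "barycenter f \<in> interior (\<Union>\<T>)" using barycenter_face_in_dual_cell f int by blast
    have w: "?w f \<bullet> (x - y) = 0" if xy: "x \<in> f" "y \<in> f" for x y
    proof -
      obtain c where c: "c \<in> \<T>" "f facet_of c" using fg(1) by (auto simp: grid_faces_def)
      then have cn: "c \<in> cells_at \<T> n" "e \<subseteq> c" using f fg facet_of_imp_subset by (auto simp: cells_at_def)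
      obtain p q r s where t: "tetrahedron n p q r" "c = convex hull {n, p, q, r}" "e = convex hull {n, p}"
        "edge_vec oe e = s *\<^sub>R (p - n)" using edge[OF cn] by blast
      have "f \<in> {convex hull {n, p, q}, convex hull {n, p, r}}"
        using tetrahedron.facets_containing_edge[OF t(1)] c(2) f unfolding t(2,3) by blast
      then consider "f = convex hull {n, p, q}" | "f = convex hull {n, p, r}" by blast
      then show ?thesis
      proof cases
        case 1
        show ?thesis using xy unfolding t(4) unfolding t(3) 1 by (rule tetrahedron.edge_face_normal[OF t(1)])
      next
        case 2
        show ?thesis using xy unfolding t(4) unfolding t(3) 2
          by (rule tetrahedron.edge_face_normal[OF tetrahedron.swap(2)[OF t(1)]])
      qed
    qed
    show "(\<Sum>c\<in>cells_containing \<T> f. ?g f c) = 0"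
      using sum_sgn_sides[OF fg(1) b w] unfolding scaleR_left.sum[symmetric] by simp
  qed
  finally show ?thesis by simp
qed

end

theorem lemma5:
  fixes \<Omega> :: "(real^3) set" and \<T> :: "(real^3) set set"
    and oe :: "(real^3) set \<Rightarrow> (real^3) \<times> (real^3)" and \<nu> :: "(real^3) set \<Rightarrow> real^3"
    and n :: "real^3"
  assumes "tetrahedral_grid \<Omega> \<T>"
    and "edge_orientation \<T> oe"
    and "face_orientation \<T> \<nu>"
    and "n \<in> grid_nodes \<T>"
  shows "(dual_cell \<T> n \<inter> frontier \<Omega> = {} \<longrightarrow>
            (\<Sum>e\<in>edges_at \<T> n. outer (edge_vec_in_dual \<T> oe n e) (dual_face_vec \<T> oe e))
              = measure lebesgue (dual_cell \<T> n) *\<^sub>R mat 1 \<and>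
            (\<Sum>f\<in>faces_at \<T> n. outer (face_vec_in_dual \<T> \<nu> n f) (dual_edge_vec \<T> \<nu> f))
              = measure lebesgue (dual_cell \<T> n) *\<^sub>R mat 1) \<and>
         (dual_cell \<T> n \<inter> frontier \<Omega> \<noteq> {} \<longrightarrow>
            (\<Sum>e\<in>edges_at \<T> n. outer (edge_vec_in_dual \<T> oe n e)
                (dual_face_vec \<T> oe e + bdry_face_vec \<T> oe n e))
              = measure lebesgue (dual_cell \<T> n) *\<^sub>R mat 1 \<and>
            (\<Sum>f\<in>faces_at \<T> n. outer (face_vec_in_dual \<T> \<nu> n f)
                (dual_edge_vec \<T> \<nu> f + bdry_edge_vec \<T> \<nu> n f))
              = measure lebesgue (dual_cell \<T> n) *\<^sub>R mat 1)"
proof -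
  interpret mesh_node \<T> n
    using assms(1,4) by unfold_locales (auto simp: tetrahedral_grid_def)
  \<comment> \<open>The grid determines only the closure of \<open>\<Omega>\<close>. A subset of
    that closure missing the frontier lies in the interior of \<open>\<Omega>\<close>, hence in the
    interior of the closure.\<close>
  have int: "dual_cell \<T> n \<subseteq> interior (\<Union>\<T>)" if "dual_cell \<T> n \<inter> frontier \<Omega> = {}"
  proof -
    have "dual_cell \<T> n \<subseteq> closure \<Omega>"
      using assms(1) dual_cell_part_subset unfolding tetrahedral_grid_def dual_cell_def cells_at_def by blast
    then have "dual_cell \<T> n \<subseteq> interior \<Omega>" using that by (auto simp: frontier_def)
    also have "\<dots> \<subseteq> interior (\<Union>\<T>)"
      using assms(1) closure_subset unfolding tetrahedral_grid_def by (metis interior_mono)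
    finally show ?thesis .
  qed
  have "(\<Sum>e\<in>edges_at \<T> n. outer (edge_vec_in_dual \<T> oe n e) (dual_face_vec \<T> oe e))
      = measure lebesgue (dual_cell \<T> n) *\<^sub>R mat 1" if "dual_cell \<T> n \<inter> frontier \<Omega> = {}"
    using sum_edges_with_bdry[OF assms(2)] bdry_face_vec_eq_0[OF assms(2) int[OF that]]
    by (simp cong: sum.cong)
  moreover have "(\<Sum>f\<in>faces_at \<T> n. outer (face_vec_in_dual \<T> \<nu> n f) (dual_edge_vec \<T> \<nu> f))
      = measure lebesgue (dual_cell \<T> n) *\<^sub>R mat 1" if "dual_cell \<T> n \<inter> frontier \<Omega> = {}"
    using sum_faces_with_bdry[OF assms(3)] bdry_edge_vec_eq_0[OF assms(3) int[OF that]]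
    by (simp cong: sum.cong)
  ultimately show ?thesis
    using sum_edges_with_bdry[OF assms(2)] sum_faces_with_bdry[OF assms(3)] by blast
qed

end
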